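(* Let $X$ and $Y$ be association schemes, and let $p:X\times Y\to X$ be the projection. Then, for any $(f,\sigma)\in\operatorname{Aut}(X\leftthreetimes Y)$, $f$ maps each fiber $Y_x:=p^{-1}(x)$ to another fiber (possibly the same one). Thus, $f$ induces an element $\pi(f)\in\operatorname{Aut}_{\mathrm{Sets}}(X)$. This gives a surjective morphism of groups $$\operatorname{Aut}(X\leftthreetimes Y)\stackrel{P}{\to}\operatorname{Aut}(X)$$ with a natural splitting morphism. Thus, we have a group isomorphism $$\operatorname{Aut}(X\leftthreetimes Y)\cong K\rtimes\operatorname{Aut}(X),$$ where $K:=\ker P$, whose structure is described as follows: $K$ is a subgroup of $\prod_{x\in X}\operatorname{Aut}(Y_x)$, and more precisely $$K=\coprod_{\tau\in T}\Bigl(\prod_{x\in X}\operatorname{Aut}(Y_x)_\tau\Bigr),$$ where $T$ is the image of $\operatorname{Aut}(Y)$ in $\operatorname{Aut}_{\mathrm{Sets}}(I_Y)$ and $\operatorname{Aut}(Y_x)_\tau$ denotes the set of elements of $\operatorname{Aut}(Y_x)$ whose $\operatorname{Aut}_{\mathrm{Sets}}(I_Y)$-component is $\tau$. We have a natural embedding of $\operatorname{Aut}(Y)$ into $K$ that acts trivially on $X$ and diagonally on each fiber $Y_x$. The image of the embedding commutes with the image of the splitting. Thus, $\operatorname{Aut}(X\leftthreetimes Y)$ has a subgroup isomorphic to $\operatorname{Aut}(Y)\times\operatorname{Aut}(X)$.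
   Context: Association scheme: a triple $(X,R,I)$ with $X,I$ finite sets and $R:X\times X\to I$ a surjection. For $i\in I$ let $A_i$ be the $0/1$ matrix indexed by $X\times X$ with entry $1$ exactly on $R^{-1}(i)$, and let $A_X$ be the complex linear span of the $A_i$. The requirements are: (1) there is $i_0\in I$ with $A_{i_0}$ the identity matrix; (2) $A_X$ is closed under the matrix product; (3) $A_X$ is closed under transpose. The scheme is often denoted just by $X$, its relation set by $I_X$ and its relation map by $R_X$; the symbol $i_0$ is used for the identity relation of every scheme. Commutativity is not assumed. Morphism from $(X,R,I)$ to $(X',R',I')$: a pair of maps $f:X\to X'$, $\sigma:I\to I'$ with $R'(f(x),f(y))=\sigma(R(x,y))$ for all $x,y\in X$. $\operatorname{Aut}(X)$ is the group of automorphisms $(f,\sigma)$ of $X$ in this category ($\sigma$ need not be the identity; $f$ determines $\sigma$). For a set $S$ with any structure, $\operatorname{Aut}_{\mathrm{Sets}}(S)$ is the group of all bijections $S\to S$, neglecting the structure. Wreath product: put $I_X\leftthreetimes I_Y:=(I_X\setminus\{i_0\})\coprod I_Y$. The association scheme $X\leftthreetimes Y$ has underlying set $X\times Y$, relation set $I_X\leftthreetimes I_Y$, and relation map $R_{\leftthreetimes}((x,y),(x',y'))=R_X(x,x')\in I_X\setminus\{i_0\}$ if $x\neq x'$, and $R_Y(y,y')\in I_Y$ if $x=x'$. The induced bijection $\pi(f)$ is characterized by $p\circ f=\pi(f)\circ p$, and $P$ sends $(f,\sigma)$ to the automorphism of $X$ with underlying bijection $\pi(f)$. Each fiber $Y_x=\{x\}\times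 Y$ is identified with $Y$ and so regarded as an association scheme with relation set $I_Y$. In the description of $K$, a family $(k_x,\tau)_{x\in X}$ with $(k_x,\tau)\in\operatorname{Aut}(Y_x)_\tau$ for one common $\tau$ is identified with the automorphism of $X\leftthreetimes Y$ given by $(x,y)\mapsto(x,k_x(y))$ on $X\times Y$ and by the identity on $I_X\setminus\{i_0\}$ and $\tau$ on $I_Y$. *)

theory Defs
  imports Complex_Main "HOL-Algebra.Bij" "HOL-Algebra.Product_Groups"
begin

section \<open>Association schemes\<close>

record ('a, 'i) scheme =
  points :: "'a set"
  relmap :: "'a \<Rightarrow> 'a \<Rightarrow> 'i"
  rels :: "'i set"

text \<open>Matrices indexed by \<open>points S\<close> are functions of two arguments that vanish outside
  \<open>points S \<times> points S\<close>.\<close>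

definition adj :: "('a, 'i) scheme \<Rightarrow> 'i \<Rightarrow> 'a \<Rightarrow> 'a \<Rightarrow> complex" where
  "adj S i = (\<lambda>x y. if x \<in> points S \<and> y \<in> points S \<and> relmap S x y = i then 1 else 0)"

definition id_mat :: "('a, 'i) scheme \<Rightarrow> 'a \<Rightarrow> 'a \<Rightarrow> complex" where
  "id_mat S = (\<lambda>x y. if x \<in> points S \<and> x = y then 1 else 0)"

definition mat_mult ::
    "('a, 'i) scheme \<Rightarrow> ('a \<Rightarrow> 'a \<Rightarrow> complex) \<Rightarrow> ('a \<Rightarrow> 'a \<Rightarrow> complex) \<Rightarrow> 'a \<Rightarrow> 'a \<Rightarrow> complex" where
  "mat_mult S M N = (\<lambda>x z. \<Sum>y\<in>points S. M x y * N y z)"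

definition adj_span :: "('a, 'i) scheme \<Rightarrow> ('a \<Rightarrow> 'a \<Rightarrow> complex) set" where
  "adj_span S = {\<lambda>x y. \<Sum>i\<in>rels S. c i * adj S i x y | c. True}"

definition assoc_scheme :: "('a, 'i) scheme \<Rightarrow> bool" where
  "assoc_scheme S \<longleftrightarrow>
     finite (points S) \<and> finite (rels S) \<and>
     (\<lambda>(x, y). relmap S x y) ` (points S \<times> points S) = rels S \<and>
     (\<exists>i\<in>rels S. adj S i = id_mat S) \<and>
     (\<forall>M\<in>adj_span S. \<forall>N\<in>adj_span S. mat_mult S M N \<in> adj_span S) \<and>
     (\<forall>M\<in>adj_span S. (\<lambda>x y. M y x) \<in> adj_span S)"

definition id_rel :: "('a, 'i) scheme \<Rightarrow> 'i" where
  "id_rel S = (THE i. i \<in> rels S \<and> adj S i = id_mat S)"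

lemma adj_span_iff:
  assumes "finite (rels S)" and "\<And>x y. x \<in> points S \<Longrightarrow> y \<in> points S \<Longrightarrow> relmap S x y \<in> rels S"
  shows "M \<in> adj_span S \<longleftrightarrow>
    (\<exists>c. M = (\<lambda>x y. if x \<in> points S \<and> y \<in> points S then c (relmap S x y) else 0))"
proof -
  have "(\<Sum>i\<in>rels S. c i * adj S i x y) =
      (if x \<in> points S \<and> y \<in> points S then c (relmap S x y) else 0)" for c x y
  proof (cases "x \<in> points S \<and> y \<in> points S")
    case True
    have "(\<Sum>i\<in>rels S. c i * adj S i x y) = (\<Sum>i\<in>rels S. if relmap S x y = i then c i else 0)"
      using True by (intro sum.cong) (auto simp: adj_def)
    also have "\<dots> = c (relmap S x y)"
      using True assms by (simp add: sum.delta)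
    finally show ?thesis
      using True by simp
  next
    case False
    then show ?thesis
      by (auto simp: adj_def)
  qed
  then show ?thesis
    by (auto simp: adj_span_def)
qed

lemma assoc_scheme_rel_in:
  assumes "assoc_scheme S" "x \<in> points S" "y \<in> points S"
  shows "relmap S x y \<in> rels S"
  using assms unfolding assoc_scheme_def by (metis (no_types, lifting) SigmaI case_prod_conv image_eqI)

lemma id_rel_props:
  assumes S: "assoc_scheme S"
  shows "id_rel S \<in> rels S" "adj S (id_rel S) = id_mat S"
    and "\<And>x y. x \<in> points S \<Longrightarrow> y \<in> points S \<Longrightarrow> relmap S x y = id_rel S \<longleftrightarrow> x = y"
proof -
  obtain i where i: "i \<in> rels S" "adj S i = id_mat S"
    using S by (auto simp: assoc_scheme_def)
  have eq: "relmap S x y = j \<longleftrightarrow> x = y"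
    if "adj S j = id_mat S" "x \<in> points S" "y \<in> points S" for j x y
    using fun_cong[OF fun_cong[OF that(1)], of x y] that(2,3)
    by (auto simp: adj_def id_mat_def split: if_splits)
  obtain x where x: "x \<in> points S"
    using S i(1) unfolding assoc_scheme_def by blast
  have "id_rel S = i"
    unfolding id_rel_def
  proof (rule the_equality)
    show "i \<in> rels S \<and> adj S i = id_mat S"
      using i by simp
    show "j = i" if "j \<in> rels S \<and> adj S j = id_mat S" for j
      using eq[of i x x] eq[of j x x] i that x by auto
  qed
  then show "id_rel S \<in> rels S" "adj S (id_rel S) = id_mat S"
    and "\<And>x y. x \<in> points S \<Longrightarrow> y \<in> points S \<Longrightarrow> relmap S x y = id_rel S \<longleftrightarrow> x = y"
    using i eq by auto
qed

lemma assoc_scheme_mult: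
  assumes S: "assoc_scheme S"
  obtains e where "\<And>x z. x \<in> points S \<Longrightarrow> z \<in> points S \<Longrightarrow>
    (\<Sum>y\<in>points S. c (relmap S x y) * d (relmap S y z)) = (e (relmap S x z) :: complex)"
proof -
  note iff = adj_span_iff[of S, OF _ assoc_scheme_rel_in[OF S]]
  let ?m = "\<lambda>c x y. if x \<in> points S \<and> y \<in> points S then c (relmap S x y) else 0 :: complex"
  have fin: "finite (rels S)"
    using S by (simp add: assoc_scheme_def)
  have "mat_mult S (?m c) (?m d) \<in> adj_span S"
    using S iff[OF fin] unfolding assoc_scheme_def by blast
  then obtain e where "mat_mult S (?m c) (?m d) = ?m e"
    using iff[OF fin] by blast
  then have eq: "mat_mult S (?m c) (?m d) x z = ?m e x z" for x z
    by meson
  have "(\<Sum>y\<in>points S. c (relmap S x y) * d (relmap S y z)) = e (relmap S x z)"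
    if "x \<in> points S" "z \<in> points S" for x z
  proof -
    have "(\<Sum>y\<in>points S. c (relmap S x y) * d (relmap S y z)) = mat_mult S (?m c) (?m d) x z"
      unfolding mat_mult_def using that by (intro sum.cong) auto
    then show ?thesis
      using that eq[of x z] by simp
  qed
  then show ?thesis
    using that by blast
qed

lemma assoc_scheme_transpose:
  assumes S: "assoc_scheme S"
  obtains e where "\<And>x y. x \<in> points S \<Longrightarrow> y \<in> points S \<Longrightarrow>
    c (relmap S y x) = (e (relmap S x y) :: complex)"
proof -
  note iff = adj_span_iff[of S, OF _ assoc_scheme_rel_in[OF S]]
  let ?m = "\<lambda>c x y. if x \<in> points S \<and> y \<in> points S then c (relmap S x y) else 0 :: complex"
  have fin: "finite (rels S)"
    using S by (simp add: assoc_scheme_def)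
  have "?m c \<in> adj_span S"
    using iff[OF fin] by blast
  moreover have "\<forall>M\<in>adj_span S. (\<lambda>x y. M y x) \<in> adj_span S"
    using S by (simp add: assoc_scheme_def)
  ultimately have "(\<lambda>x y. ?m c y x) \<in> adj_span S"
    by (rule bspec[rotated])
  then obtain e where "(\<lambda>x y. ?m c y x) = ?m e"
    using iff[OF fin] by blast
  then have "?m c y x = ?m e x y" for x y
    by metis
  then show ?thesis
    using that[of e] by metis
qed


section \<open>Morphisms and automorphism groups\<close>

text \<open>The two components of a morphism are maps with domain the point set and the relation set;
  they are taken extensional, so that equality of morphisms is equality of these maps.\<close>

definition scheme_mor ::
    "('a, 'i) scheme \<Rightarrow> ('b, 'j) scheme \<Rightarrow> (('a \<Rightarrow> 'b) \<times> ('i \<Rightarrow> 'j)) set" where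
  "scheme_mor S S' = {(f, \<sigma>).
     f \<in> points S \<rightarrow>\<^sub>E points S' \<and> \<sigma> \<in> rels S \<rightarrow>\<^sub>E rels S' \<and>
     (\<forall>x\<in>points S. \<forall>y\<in>points S. relmap S' (f x) (f y) = \<sigma> (relmap S x y))}"

definition scheme_End :: "('a, 'i) scheme \<Rightarrow> (('a \<Rightarrow> 'a) \<times> ('i \<Rightarrow> 'i)) monoid" where
  "scheme_End S =
     \<lparr>carrier = scheme_mor S S,
      mult = (\<lambda>(g, \<rho>) (f, \<sigma>). (compose (points S) g f, compose (rels S) \<rho> \<sigma>)),
      one = (\<lambda>x\<in>points S. x, \<lambda>i\<in>rels S. i)\<rparr>"

definition scheme_Aut :: "('a, 'i) scheme \<Rightarrow> (('a \<Rightarrow> 'a) \<times> ('i \<Rightarrow> 'i)) monoid" where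
  "scheme_Aut S = units_of (scheme_End S)"

definition scheme_Aut_over ::
    "('a, 'i) scheme \<Rightarrow> ('i \<Rightarrow> 'i) \<Rightarrow> (('a \<Rightarrow> 'a) \<times> ('i \<Rightarrow> 'i)) set" where
  "scheme_Aut_over S \<tau> = {\<phi> \<in> carrier (scheme_Aut S). snd \<phi> = \<tau>}"


section \<open>Wreath products\<close>

definition wreath :: "('a, 'i) scheme \<Rightarrow> ('b, 'j) scheme \<Rightarrow> ('a \<times> 'b, 'i + 'j) scheme" where
  "wreath X Y =
     \<lparr>points = points X \<times> points Y,
      relmap = (\<lambda>(x, y) (x', y').
        if x \<noteq> x' then Inl (relmap X x x') else Inr (relmap Y y y')),
      rels = (rels X - {id_rel X}) <+> rels Y\<rparr>"

lemma assoc_scheme_wreath: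
  assumes X: "assoc_scheme X" and Y: "assoc_scheme Y"
  shows "assoc_scheme (wreath X Y)"
proof -
  let ?W = "wreath X Y"
  note iX = id_rel_props[OF X] and iY = id_rel_props[OF Y]
  have finX: "finite (points X)" "finite (rels X)" and finY: "finite (points Y)" "finite (rels Y)"
    using X Y by (auto simp: assoc_scheme_def)
  have surX: "\<exists>x\<in>points X. \<exists>y\<in>points X. relmap X x y = i" if "i \<in> rels X" for i
  proof -
    have "i \<in> (\<lambda>(x, y). relmap X x y) ` (points X \<times> points X)"
      using X that by (simp add: assoc_scheme_def)
    then show ?thesis
      by auto
  qed
  have surY: "\<exists>x\<in>points Y. \<exists>y\<in>points Y. relmap Y x y = i" if "i \<in> rels Y" for i
  proof -
    have "i \<in> (\<lambda>(x, y). relmap Y x y) ` (points Y \<times> points Y)"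
      using Y that by (simp add: assoc_scheme_def)
    then show ?thesis
      by auto
  qed
  obtain x0 where x0: "x0 \<in> points X"
    using surX[OF iX(1)] by blast
  obtain y0 where y0: "y0 \<in> points Y"
    using surY[OF iY(1)] by blast
  have ptsW: "points ?W = points X \<times> points Y"
    and relW: "relmap ?W (x, y) (x', y') =
      (if x \<noteq> x' then Inl (relmap X x x') else Inr (relmap Y y y'))"
    and relsW: "rels ?W = (rels X - {id_rel X}) <+> rels Y" for x y x' y'
    by (auto simp: wreath_def)
  have inW: "relmap ?W z z' \<in> rels ?W" if "z \<in> points ?W" "z' \<in> points ?W" for z z'
    using that iX(3) assoc_scheme_rel_in[OF X] assoc_scheme_rel_in[OF Y]
    by (cases z; cases z') (auto simp: ptsW relW relsW)
  have finW: "finite (points ?W)" "finite (rels ?W)"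
    using finX finY by (auto simp: ptsW relsW)
  have "rels ?W \<subseteq> (\<lambda>(z, z'). relmap ?W z z') ` (points ?W \<times> points ?W)"
  proof
    fix r assume "r \<in> rels ?W"
    then consider i where "r = Inl i" "i \<in> rels X" "i \<noteq> id_rel X" | j where "r = Inr j" "j \<in> rels Y"
      by (auto simp: relsW)
    then have "\<exists>z\<in>points ?W. \<exists>z'\<in>points ?W. r = relmap ?W z z'"
    proof cases
      case 1
      obtain x x' where x: "x \<in> points X" "x' \<in> points X" "relmap X x x' = i"
        using surX[OF 1(2)] by blast
      then have "x \<noteq> x'"
        using iX(3) 1(3) by blast
      then show ?thesis
        using x y0 1 by (intro bexI[of _ "(x, y0)"] bexI[of _ "(x', y0)"]) (auto simp: ptsW relW)
    next
      case 2
      obtain y y' where "y \<in> points Y" "y' \<in> points Y" "relmap Y y y' = j"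
        using surY[OF 2(2)] by blast
      then show ?thesis
        using x0 2 by (intro bexI[of _ "(x0, y)"] bexI[of _ "(x0, y')"]) (auto simp: ptsW relW)
    qed
    then show "r \<in> (\<lambda>(z, z'). relmap ?W z z') ` (points ?W \<times> points ?W)"
      by force
  qed
  then have surW: "(\<lambda>(z, z'). relmap ?W z z') ` (points ?W \<times> points ?W) = rels ?W"
    using inW by auto
  have idW: "\<exists>r\<in>rels ?W. adj ?W r = id_mat ?W"
  proof
    show "Inr (id_rel Y) \<in> rels ?W"
      using iY(1) by (auto simp: relsW)
    show "adj ?W (Inr (id_rel Y)) = id_mat ?W"
      using iY(3) by (intro ext) (auto simp: adj_def id_mat_def ptsW relW split: if_splits)
  qed
  have iff: "M \<in> adj_span ?W \<longleftrightarrow>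
      (\<exists>c. M = (\<lambda>x y. if x \<in> points ?W \<and> y \<in> points ?W then c (relmap ?W x y) else 0))" for M
    using finW(2) inW by (rule adj_span_iff)
  have mult: "mat_mult ?W M N \<in> adj_span ?W" if "M \<in> adj_span ?W" "N \<in> adj_span ?W" for M N
  proof -
    obtain c d where
        M: "M = (\<lambda>x y. if x \<in> points ?W \<and> y \<in> points ?W then c (relmap ?W x y) else 0)" and
        N: "N = (\<lambda>x y. if x \<in> points ?W \<and> y \<in> points ?W then d (relmap ?W x y) else 0)"
      using \<open>M \<in> adj_span ?W\<close> \<open>N \<in> adj_span ?W\<close> unfolding iff by blast
    define cX where "cX i = (if i = id_rel X then 0 else c (Inl i))" for i
    define dX where "dX i = (if i = id_rel X then 0 else d (Inl i))" for i
    define cY where "cY j = c (Inr j)" for j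
    define dY where "dY j = d (Inr j)" for j
    obtain e where e: "\<And>x z. x \<in> points X \<Longrightarrow> z \<in> points X \<Longrightarrow>
        (\<Sum>y\<in>points X. cX (relmap X x y) * dX (relmap X y z)) = e (relmap X x z)"
      using assoc_scheme_mult[OF X, of cX dX] by blast
    obtain g where g: "\<And>x z. x \<in> points Y \<Longrightarrow> z \<in> points Y \<Longrightarrow>
        (\<Sum>y\<in>points Y. cY (relmap Y x y) * dY (relmap Y y z)) = g (relmap Y x z)"
      using assoc_scheme_mult[OF Y, of cY dY] by blast
    obtain a where a: "\<And>x z. x \<in> points Y \<Longrightarrow> z \<in> points Y \<Longrightarrow>
        (\<Sum>y\<in>points Y. cY (relmap Y x y) * 1) = a (relmap Y x z)"
      using assoc_scheme_mult[OF Y, of cY "\<lambda>_. 1"] by blast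
    obtain b where b: "\<And>x z. x \<in> points Y \<Longrightarrow> z \<in> points Y \<Longrightarrow>
        (\<Sum>y\<in>points Y. 1 * dY (relmap Y y z)) = b (relmap Y x z)"
      using assoc_scheme_mult[OF Y, of "\<lambda>_. 1" dY] by blast
    have a': "(\<Sum>y'\<in>points Y. cY (relmap Y y y')) = a (id_rel Y)" if "y \<in> points Y" for y
      using a[OF that that] iY(3)[OF that that] by simp
    have b': "(\<Sum>y'\<in>points Y. dY (relmap Y y' y)) = b (id_rel Y)" if "y \<in> points Y" for y
      using b[OF that that] iY(3)[OF that that] by simp
    have split: "c (relmap ?W (x, y) (x', y')) =
          cX (relmap X x x') + (if x = x' then cY (relmap Y y y') else 0)"
        "d (relmap ?W (x, y) (x', y')) =
          dX (relmap X x x') + (if x = x' then dY (relmap Y y y') else 0)"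
      if "x \<in> points X" "x' \<in> points X" for x y x' y'
      using iX(3)[OF that] by (auto simp: relW cX_def dX_def cY_def dY_def)
    define n where "n = (of_nat (card (points Y)) :: complex)"
    define h where "h r = (case r of
        Inl i \<Rightarrow> n * e i + cX i * b (id_rel Y) + a (id_rel Y) * dX i
      | Inr j \<Rightarrow> n * e (id_rel X) + g j)" for r
    have "mat_mult ?W M N (x, y) (z, w) = h (relmap ?W (x, y) (z, w))"
      if x: "x \<in> points X" and y: "y \<in> points Y" and z: "z \<in> points X" and w: "w \<in> points Y"
      for x y z w
    proof -
      have "mat_mult ?W M N (x, y) (z, w) =
        (\<Sum>u\<in>points X. \<Sum>v\<in>points Y.
          c (relmap ?W (x, y) (u, v)) * d (relmap ?W (u, v) (z, w)))"
        unfolding mat_mult_def M N using x y z w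
        by (simp add: ptsW sum.cartesian_product cong: sum.cong)
      also have "\<dots> = (\<Sum>u\<in>points X. \<Sum>v\<in>points Y.
           cX (relmap X x u) * dX (relmap X u z)
           + (if u = z then cX (relmap X x u) * dY (relmap Y v w) else 0)
           + (if x = u then cY (relmap Y y v) * dX (relmap X u z) else 0)
           + (if x = u then (if u = z then cY (relmap Y y v) * dY (relmap Y v w) else 0) else 0))"
        using x z by (intro sum.cong refl) (simp add: split algebra_simps)
      also have "\<dots> = (\<Sum>u\<in>points X.
           n * (cX (relmap X x u) * dX (relmap X u z))
           + (if u = z then cX (relmap X x u) * b (id_rel Y) else 0)
           + (if x = u then a (id_rel Y) * dX (relmap X u z) else 0)
           + (if x = u then (if u = z then g (relmap Y y w) else 0) else 0))"
        using y w
        by (intro sum.cong refl)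
          (auto simp: sum.distrib n_def a' b' g simp flip: sum_distrib_left sum_distrib_right)
      also have "\<dots> = n * e (relmap X x z) + cX (relmap X x z) * b (id_rel Y)
           + a (id_rel Y) * dX (relmap X x z) + (if x = z then g (relmap Y y w) else 0)"
        using finX x z by (simp add: sum.distrib sum.delta' sum.delta e flip: sum_distrib_left)
      also have "\<dots> = h (relmap ?W (x, y) (z, w))"
        using iX(3)[OF x z] by (auto simp: h_def relW cX_def dX_def)
      finally show ?thesis .
    qed
    moreover have "mat_mult ?W M N p q = 0" if "\<not> (p \<in> points ?W \<and> q \<in> points ?W)" for p q
      using that unfolding mat_mult_def M N by (intro sum.neutral) auto
    ultimately have "mat_mult ?W M N =
        (\<lambda>p q. if p \<in> points ?W \<and> q \<in> points ?W then h (relmap ?W p q) else 0)"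
      by (intro ext) (auto simp: ptsW)
    then show ?thesis
      unfolding iff by blast
  qed
  have trans: "(\<lambda>p q. M q p) \<in> adj_span ?W" if MW: "M \<in> adj_span ?W" for M
  proof -
    obtain c where
        M: "M = (\<lambda>x y. if x \<in> points ?W \<and> y \<in> points ?W then c (relmap ?W x y) else 0)"
      using MW unfolding iff by blast
    obtain e where e: "\<And>x y. x \<in> points X \<Longrightarrow> y \<in> points X \<Longrightarrow>
        c (Inl (relmap X y x)) = e (relmap X x y)"
      using assoc_scheme_transpose[OF X, of "\<lambda>i. c (Inl i)"] by blast
    obtain g where g: "\<And>x y. x \<in> points Y \<Longrightarrow> y \<in> points Y \<Longrightarrow>
        c (Inr (relmap Y y x)) = g (relmap Y x y)"
      using assoc_scheme_transpose[OF Y, of "\<lambda>j. c (Inr j)"] by blast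
    have "(\<lambda>p q. M q p) =
        (\<lambda>p q. if p \<in> points ?W \<and> q \<in> points ?W then case_sum e g (relmap ?W p q) else 0)"
      by (intro ext) (auto simp: M ptsW relW e g)
    then show ?thesis
      unfolding iff by blast
  qed
  show ?thesis
    unfolding assoc_scheme_def using finW surW idW mult trans by blast
qed

definition fiber :: "('a, 'i) scheme \<Rightarrow> ('b, 'j) scheme \<Rightarrow> 'a \<Rightarrow> ('a \<times> 'b) set" where
  "fiber X Y x = {z \<in> points (wreath X Y). fst z = x}"

definition fiber_scheme ::
    "('a, 'i) scheme \<Rightarrow> ('b, 'j) scheme \<Rightarrow> 'a \<Rightarrow> ('a \<times> 'b, 'j) scheme" where
  "fiber_scheme X Y x =
     \<lparr>points = fiber X Y x, relmap = (\<lambda>z z'. relmap Y (snd z) (snd z')), rels = rels Y\<rparr>"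

text \<open>Characterized by \<open>p \<circ> f = \<pi> f \<circ> p\<close>, where \<open>p\<close> is the first projection.
  \<open>BijGroup A\<close> is the group of all bijections of \<open>A\<close>.\<close>

definition induced_bij ::
    "('a, 'i) scheme \<Rightarrow> ('b, 'j) scheme \<Rightarrow> ('a \<times> 'b \<Rightarrow> 'a \<times> 'b) \<Rightarrow> 'a \<Rightarrow> 'a" where
  "induced_bij X Y f = (THE g. g \<in> carrier (BijGroup (points X)) \<and>
     (\<forall>z\<in>points (wreath X Y). fst (f z) = g (fst z)))"

definition wreath_P ::
    "('a, 'i) scheme \<Rightarrow> ('b, 'j) scheme \<Rightarrow>
     ('a \<times> 'b \<Rightarrow> 'a \<times> 'b) \<times> ('i + 'j \<Rightarrow> 'i + 'j) \<Rightarrow> ('a \<Rightarrow> 'a) \<times> ('i \<Rightarrow> 'i)" where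
  "wreath_P X Y = (\<lambda>(f, \<sigma>).
     THE \<phi>. \<phi> \<in> carrier (scheme_Aut X) \<and> fst \<phi> = induced_bij X Y f)"

definition wreath_K ::
    "('a, 'i) scheme \<Rightarrow> ('b, 'j) scheme \<Rightarrow>
     (('a \<times> 'b \<Rightarrow> 'a \<times> 'b) \<times> ('i + 'j \<Rightarrow> 'i + 'j)) monoid" where
  "wreath_K X Y = (scheme_Aut (wreath X Y))
     \<lparr>carrier := kernel (scheme_Aut (wreath X Y)) (scheme_Aut X) (wreath_P X Y)\<rparr>"

definition wreath_split ::
    "('a, 'i) scheme \<Rightarrow> ('b, 'j) scheme \<Rightarrow>
     ('a \<Rightarrow> 'a) \<times> ('i \<Rightarrow> 'i) \<Rightarrow> ('a \<times> 'b \<Rightarrow> 'a \<times> 'b) \<times> ('i + 'j \<Rightarrow> 'i + 'j)" where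
  "wreath_split X Y = (\<lambda>(g, \<rho>).
     (\<lambda>(x, y)\<in>points (wreath X Y). (g x, y), \<lambda>r\<in>rels (wreath X Y). map_sum \<rho> id r))"

definition wreath_diag ::
    "('a, 'i) scheme \<Rightarrow> ('b, 'j) scheme \<Rightarrow>
     ('b \<Rightarrow> 'b) \<times> ('j \<Rightarrow> 'j) \<Rightarrow> ('a \<times> 'b \<Rightarrow> 'a \<times> 'b) \<times> ('i + 'j \<Rightarrow> 'i + 'j)" where
  "wreath_diag X Y = (\<lambda>(k, \<tau>).
     (\<lambda>(x, y)\<in>points (wreath X Y). (x, k y), \<lambda>r\<in>rels (wreath X Y). map_sum id \<tau> r))"

text \<open>The identification of a family of automorphisms of the fibers, all with the same
  relation component \<open>\<tau>\<close>, with an automorphism of the wreath product. The underlying bijection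
  of \<open>k x\<close> acts on \<open>{x} \<times> points Y\<close>.\<close>

definition wreath_glue ::
    "('a, 'i) scheme \<Rightarrow> ('b, 'j) scheme \<Rightarrow> ('j \<Rightarrow> 'j) \<Rightarrow>
     ('a \<Rightarrow> ('a \<times> 'b \<Rightarrow> 'a \<times> 'b) \<times> ('j \<Rightarrow> 'j)) \<Rightarrow>
     ('a \<times> 'b \<Rightarrow> 'a \<times> 'b) \<times> ('i + 'j \<Rightarrow> 'i + 'j)" where
  "wreath_glue X Y \<tau> k =
     (\<lambda>z\<in>points (wreath X Y). fst (k (fst z)) z, \<lambda>r\<in>rels (wreath X Y). map_sum id \<tau> r)"

definition wreath_restrict ::
    "('a, 'i) scheme \<Rightarrow> ('b, 'j) scheme \<Rightarrow>
     ('a \<times> 'b \<Rightarrow> 'a \<times> 'b) \<times> ('i + 'j \<Rightarrow> 'i + 'j) \<Rightarrow>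
     'a \<Rightarrow> ('a \<times> 'b \<Rightarrow> 'a \<times> 'b) \<times> ('j \<Rightarrow> 'j)" where
  "wreath_restrict X Y = (\<lambda>(f, \<sigma>). \<lambda>x\<in>points X.
     (restrict f (fiber X Y x), \<lambda>j\<in>rels Y. projr (\<sigma> (Inr j))))"


section \<open>Semidirect products\<close>

definition semidirect ::
    "('n, 'c) monoid_scheme \<Rightarrow> ('h, 'd) monoid_scheme \<Rightarrow> ('h \<Rightarrow> 'n \<Rightarrow> 'n) \<Rightarrow> ('n \<times> 'h) monoid" where
  "semidirect N H \<alpha> =
     \<lparr>carrier = carrier N \<times> carrier H,
      mult = (\<lambda>(n, h) (n', h'). (n \<otimes>\<^bsub>N\<^esub> \<alpha> h n', h \<otimes>\<^bsub>H\<^esub> h')),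
      one = (\<one>\<^bsub>N\<^esub>, \<one>\<^bsub>H\<^esub>)\<rparr>"

definition wreath_act ::
    "('a, 'i) scheme \<Rightarrow> ('b, 'j) scheme \<Rightarrow> ('a \<Rightarrow> 'a) \<times> ('i \<Rightarrow> 'i) \<Rightarrow>
     ('a \<times> 'b \<Rightarrow> 'a \<times> 'b) \<times> ('i + 'j \<Rightarrow> 'i + 'j) \<Rightarrow>
     ('a \<times> 'b \<Rightarrow> 'a \<times> 'b) \<times> ('i + 'j \<Rightarrow> 'i + 'j)" where
  "wreath_act X Y a = (\<lambda>k\<in>carrier (wreath_K X Y).
     wreath_split X Y a \<otimes>\<^bsub>scheme_Aut (wreath X Y)\<^esub> k \<otimes>\<^bsub>scheme_Aut (wreath X Y)\<^esub>
       inv\<^bsub>scheme_Aut (wreath X Y)\<^esub> (wreath_split X Y a))"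

end

theory Submission
  imports Defs
begin

text \<open>
The wreath product carries a visible equivalence relation: two points lie in the same fiber exactly
when their relation is one of the \<open>Inr j\<close>. An automorphism may permute the relations, so it is not
clear at first that this equivalence survives. It does because of a count. If two points of one
fiber were sent to points over different base points, the relation between the images would be
some \<open>Inl i\<close>, and such a relation does not see the second coordinate; so a whole fiber would stand in
that relation to the first image. Pulling back, a fiber would contain the preimage of a whole fiber
together with one further point, which is too many points for a finite set
(\<open>aut_respects_fibers\<close>).

Once fibers go to fibers, the automorphism induces a permutation of the base, and the relations
\<open>Inl i\<close> record that this permutation respects the relations of \<open>X\<close> (\<open>base_aut\<close>). Letting an
automorphism of \<open>X\<close> act on first coordinates splits the resulting homomorphism, so that the
semidirect decomposition is an instance of the general fact about split extensions
(\<open>semidirect_iso\<close>, \<open>iso_semidirect\<close>).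

A kernel element maps every fiber to itself. All its restrictions to fibers have the same effect
on \<open>rels Y\<close>, because the relations inside different fibers share the names \<open>Inr j\<close>. Conversely,
automorphisms of the fibers with a common effect on \<open>rels Y\<close> can be glued, since relations between
points of different fibers do not depend on second coordinates. Restriction and gluing are mutually
inverse (\<open>wreath_glue_bij\<close>).

Throughout, an automorphism is determined by its action on points, the relation map being surjective
(\<open>scheme_Aut_eqI\<close>); identities between automorphisms are therefore checked pointwise.
\<close>

section \<open>Split extensions of groups\<close>

locale split_extension = group_hom G H P for G (structure) and H (structure) and P +
  fixes s
  assumes section_hom: "s \<in> hom H G"
    and section_id: "a \<in> carrier H \<Longrightarrow> P (s a) = a"
begin

abbreviation "N \<equiv> G\<lparr>carrier := kernel G H P\<rparr>"

abbreviation "conj_act \<equiv> \<lambda>a. \<lambda>k\<in>kernel G H P. s a \<otimes> k \<otimes> inv (s a)"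

lemma section_closed: "a \<in> carrier H \<Longrightarrow> s a \<in> carrier G"
  using section_hom by (auto simp: hom_def)

lemma section_mult: "a \<in> carrier H \<Longrightarrow> b \<in> carrier H \<Longrightarrow> s (a \<otimes>\<^bsub>H\<^esub> b) = s a \<otimes> s b"
  using section_hom by (auto simp: hom_def)

lemma kernelI: "k \<in> carrier G \<Longrightarrow> P k = \<one>\<^bsub>H\<^esub> \<Longrightarrow> k \<in> kernel G H P"
  and kernel_closed: "k \<in> kernel G H P \<Longrightarrow> k \<in> carrier G"
  and kernel_P: "k \<in> kernel G H P \<Longrightarrow> P k = \<one>\<^bsub>H\<^esub>"
  by (auto simp: kernel_def)

lemma conj_closed:
  assumes "a \<in> carrier H" "k \<in> kernel G H P"
  shows "s a \<otimes> k \<otimes> inv (s a) \<in> kernel G H P"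
  using assms by (intro kernelI) (simp_all add: section_closed section_id kernel_closed kernel_P)

lemma conj_conj:
  assumes "a \<in> carrier H" "b \<in> carrier H" "k \<in> kernel G H P"
  shows "s a \<otimes> (s b \<otimes> k \<otimes> inv (s b)) \<otimes> inv (s a) =
    s (a \<otimes>\<^bsub>H\<^esub> b) \<otimes> k \<otimes> inv (s (a \<otimes>\<^bsub>H\<^esub> b))"
  using assms by (simp add: section_closed kernel_closed section_mult G.m_assoc G.inv_mult_group)

lemma section_one: "s \<one>\<^bsub>H\<^esub> = \<one>"
  using Group.hom_one[OF section_hom H.is_group G.is_group] .

text \<open>
The inverse of conjugation by \<open>s a\<close> is conjugation by \<open>s (inv a)\<close>, again of this form because \<open>s\<close> is a
homomorphism.
\<close>

lemma conj_act_auto: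
  assumes a: "a \<in> carrier H"
  shows "conj_act a \<in> auto N"
proof -
  have mult: "s a \<otimes> (k \<otimes> l) \<otimes> inv (s a) = (s a \<otimes> k \<otimes> inv (s a)) \<otimes> (s a \<otimes> l \<otimes> inv (s a))"
    if "k \<in> kernel G H P" "l \<in> kernel G H P" for k l
  proof -
    have "inv (s a) \<otimes> (s a \<otimes> (l \<otimes> inv (s a))) = l \<otimes> inv (s a)"
      using that a by (simp add: kernel_closed section_closed flip: G.m_assoc)
    then show ?thesis
      using that a by (simp add: kernel_closed section_closed G.m_assoc)
  qed
  have closed: "k \<otimes> l \<in> kernel G H P" if "k \<in> kernel G H P" "l \<in> kernel G H P" for k l
    using that by (intro kernelI) (simp_all add: kernel_closed kernel_P)
  have cancel: "s b \<otimes> (s c \<otimes> k \<otimes> inv (s c)) \<otimes> inv (s b) = k"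
    if "k \<in> kernel G H P" "b \<in> carrier H" "c \<in> carrier H" "b \<otimes>\<^bsub>H\<^esub> c = \<one>\<^bsub>H\<^esub>" for k b c
    using that by (simp add: conj_conj section_one kernel_closed)
  have "bij_betw (conj_act a) (kernel G H P) (kernel G H P)"
    by (rule bij_betw_byWitness[where f' = "conj_act (inv\<^bsub>H\<^esub> a)"])
      (use a in \<open>auto simp: conj_closed cancel\<close>)
  then show ?thesis
    using a by (auto simp: auto_def hom_def Bij_def conj_closed mult closed)
qed

lemma conj_act_hom: "conj_act \<in> hom H (AutoGroup N)"
proof (rule homI)
  fix a b assume ab: "a \<in> carrier H" "b \<in> carrier H"
  have "conj_act a \<in> Bij (kernel G H P)" "conj_act b \<in> Bij (kernel G H P)"
    using conj_act_auto ab by (auto simp: auto_def)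
  then have "conj_act a \<otimes>\<^bsub>AutoGroup N\<^esub> conj_act b = compose (kernel G H P) (conj_act a) (conj_act b)"
    by (simp add: AutoGroup_def BijGroup_def)
  also have "\<dots> = conj_act (a \<otimes>\<^bsub>H\<^esub> b)"
    using ab by (auto simp: compose_def fun_eq_iff conj_closed conj_conj)
  finally show "conj_act (a \<otimes>\<^bsub>H\<^esub> b) = conj_act a \<otimes>\<^bsub>AutoGroup N\<^esub> conj_act b" ..
qed (simp add: AutoGroup_def conj_act_auto)

text \<open>
Every \<open>g\<close> factors uniquely as a kernel element times a value of \<open>s\<close>: the latter must be \<open>s (P g)\<close>.
\<close>

lemma semidirect_bij:
  shows "bij_betw (\<lambda>(k, a). k \<otimes> s a) (carrier (semidirect N H conj_act)) (carrier G)"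
  by (rule bij_betw_byWitness[where f' = "\<lambda>g. (g \<otimes> inv (s (P g)), P g)"])
    (auto simp: semidirect_def kernel_closed kernel_P section_closed section_id G.m_assoc
      intro!: kernelI)

lemma semidirect_iso: "(\<lambda>(k, a). k \<otimes> s a) \<in> iso (semidirect N H conj_act) G"
proof -
  have "(k \<otimes> (s a \<otimes> l \<otimes> inv (s a))) \<otimes> s (a \<otimes>\<^bsub>H\<^esub> b) = (k \<otimes> s a) \<otimes> (l \<otimes> s b)"
    if "k \<in> kernel G H P" "l \<in> kernel G H P" "a \<in> carrier H" "b \<in> carrier H" for k l a b
  proof -
    have "inv (s a) \<otimes> (s a \<otimes> s b) = s b"
      using that by (simp add: section_closed flip: G.m_assoc)
    then show ?thesis
      using that by (simp add: kernel_closed section_closed section_mult G.m_assoc)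
  qed
  then have "(\<lambda>(k, a). k \<otimes> s a) \<in> hom (semidirect N H conj_act) G"
    by (auto simp: hom_def semidirect_def kernel_closed section_closed)
  then show ?thesis
    using semidirect_bij by (auto simp: iso_def)
qed

lemma iso_semidirect: "G \<cong> semidirect N H conj_act"
proof -
  let ?h = "\<lambda>g. (g \<otimes> inv (s (P g)), P g)"
  have mult: "(x \<otimes> y) \<otimes> inv (s (P (x \<otimes> y))) =
      (x \<otimes> inv (s (P x))) \<otimes> (s (P x) \<otimes> (y \<otimes> inv (s (P y))) \<otimes> inv (s (P x)))"
    if xy: "x \<in> carrier G" "y \<in> carrier G" for x y
  proof -
    have "inv (s (P x)) \<otimes> (s (P x) \<otimes> (y \<otimes> (inv (s (P y)) \<otimes> inv (s (P x))))) =
        y \<otimes> (inv (s (P y)) \<otimes> inv (s (P x)))"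
      using xy by (simp add: section_closed flip: G.m_assoc)
    then show ?thesis
      using xy by (simp add: section_closed section_mult G.m_assoc G.inv_mult_group)
  qed
  have ker: "x \<otimes> inv (s (P x)) \<in> kernel G H P" if "x \<in> carrier G" for x
    using that by (intro kernelI) (simp_all add: section_closed section_id)
  have "?h \<in> hom G (semidirect N H conj_act)"
    using ker mult by (auto simp: hom_def semidirect_def)
  moreover have "bij_betw ?h (carrier G) (carrier (semidirect N H conj_act))"
    by (rule bij_betw_byWitness[where f' = "\<lambda>(k, a). k \<otimes> s a"])
      (auto simp: semidirect_def kernel_closed kernel_P section_closed section_id G.m_assoc ker)
  ultimately show ?thesis
    by (auto simp: is_iso_def iso_def)
qed

end

text \<open>
An inner direct product: commutation makes \<open>(a, b) \<mapsto> f a \<otimes> g b\<close> a homomorphism, and the last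
hypothesis says that its kernel is trivial, so that its image is the required subgroup.
\<close>

lemma commuting_product_iso:
  assumes "group G" "group H" "group K" and f: "f \<in> hom H G" and g: "g \<in> hom K G"
    and comm: "\<And>a b. a \<in> carrier H \<Longrightarrow> b \<in> carrier K \<Longrightarrow> f a \<otimes>\<^bsub>G\<^esub> g b = g b \<otimes>\<^bsub>G\<^esub> f a"
    and inj: "\<And>a b. a \<in> carrier H \<Longrightarrow> b \<in> carrier K \<Longrightarrow> f a \<otimes>\<^bsub>G\<^esub> g b = \<one>\<^bsub>G\<^esub> \<Longrightarrow>
      a = \<one>\<^bsub>H\<^esub> \<and> b = \<one>\<^bsub>K\<^esub>"
  shows "\<exists>I. subgroup I G \<and> G\<lparr>carrier := I\<rparr> \<cong> H \<times>\<times> K"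
proof -
  interpret G: group G by fact
  define h where "h = (\<lambda>(a, b). f a \<otimes>\<^bsub>G\<^esub> g b)"
  have closed: "f a \<in> carrier G" "g b \<in> carrier G" if "a \<in> carrier H" "b \<in> carrier K" for a b
    using f g that by (auto simp: hom_def)
  have mult: "f (a \<otimes>\<^bsub>H\<^esub> a') = f a \<otimes>\<^bsub>G\<^esub> f a'" "g (b \<otimes>\<^bsub>K\<^esub> b') = g b \<otimes>\<^bsub>G\<^esub> g b'"
    if "a \<in> carrier H" "a' \<in> carrier H" "b \<in> carrier K" "b' \<in> carrier K" for a a' b b'
    using f g that by (auto simp: hom_def)
  have "f a \<otimes>\<^bsub>G\<^esub> f a' \<otimes>\<^bsub>G\<^esub> (g b \<otimes>\<^bsub>G\<^esub> g b') = f a \<otimes>\<^bsub>G\<^esub> g b \<otimes>\<^bsub>G\<^esub> (f a' \<otimes>\<^bsub>G\<^esub> g b')"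
    if "a \<in> carrier H" "a' \<in> carrier H" "b \<in> carrier K" "b' \<in> carrier K" for a a' b b'
    using that comm[of a' b] by (metis G.m_assoc G.m_closed closed)
  then have hom: "h \<in> hom (H \<times>\<times> K) G"
    by (auto simp: hom_def h_def DirProd_def closed mult)
  interpret h: group_hom "H \<times>\<times> K" G h
    using assms hom by (simp add: group_hom_def group_hom_axioms_def DirProd_group)
  have "inj_on h (carrier (H \<times>\<times> K))"
    unfolding h.inj_on_one_iff using inj by (auto simp: h_def)
  then have "h \<in> iso (H \<times>\<times> K) (G\<lparr>carrier := h ` carrier (H \<times>\<times> K)\<rparr>)"
    using hom by (auto simp: iso_def bij_betw_def hom_def)
  then have "H \<times>\<times> K \<cong> G\<lparr>carrier := h ` carrier (H \<times>\<times> K)\<rparr>"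
    by (auto simp: is_iso_def)
  then show ?thesis
    using h.G.iso_sym h.img_is_subgroup by blast
qed

section \<open>Automorphisms are relation-compatible permutations of the points\<close>

text \<open>
The part of the axioms of an association scheme that governs its automorphisms. It is isolated
because a fiber \<open>fiber_scheme X Y x\<close> inherits it from \<open>Y\<close> at once, whereas the axioms about
matrices would have to be transported.
\<close>

definition relation_structure :: "('a, 'i) scheme \<Rightarrow> bool" where
  "relation_structure S \<longleftrightarrow> finite (rels S) \<and>
     (\<lambda>(x, y). relmap S x y) ` (points S \<times> points S) = rels S"

lemma assoc_scheme_relation_structure: "assoc_scheme S \<Longrightarrow> relation_structure S"
  by (simp add: assoc_scheme_def relation_structure_def)

lemma relmap_in_rels:
  "relation_structure S \<Longrightarrow> x \<in> points S \<Longrightarrow> y \<in> points S \<Longrightarrow> relmap S x y \<in> rels S"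
  unfolding relation_structure_def by fastforce

lemma rels_obtain:
  assumes "relation_structure S" "r \<in> rels S"
  obtains x y where "x \<in> points S" "y \<in> points S" "relmap S x y = r"
proof -
  have "r \<in> (\<lambda>(x, y). relmap S x y) ` (points S \<times> points S)"
    using assms by (simp add: relation_structure_def)
  then show ?thesis
    using that by auto
qed

lemma scheme_mor_iff:
  "(f, \<sigma>) \<in> scheme_mor S T \<longleftrightarrow> f \<in> points S \<rightarrow>\<^sub>E points T \<and> \<sigma> \<in> rels S \<rightarrow>\<^sub>E rels T \<and>
     (\<forall>x\<in>points S. \<forall>y\<in>points S. relmap T (f x) (f y) = \<sigma> (relmap S x y))"
  by (simp add: scheme_mor_def)

lemma scheme_mor_eqI:
  assumes S: "relation_structure S"
    and "(f, \<sigma>) \<in> scheme_mor S T" "(g, \<rho>) \<in> scheme_mor S T"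
    and "\<And>x. x \<in> points S \<Longrightarrow> f x = g x"
  shows "(f, \<sigma>) = (g, \<rho>)"
proof -
  have "\<sigma> r = \<rho> r" if "r \<in> rels S" for r
  proof -
    obtain x y where xy: "x \<in> points S" "y \<in> points S" and r: "relmap S x y = r"
      using rels_obtain[OF S \<open>r \<in> rels S\<close>] .
    have "\<sigma> r = relmap T (f x) (f y)" "\<rho> r = relmap T (g x) (g y)"
      using assms(2,3) xy r unfolding scheme_mor_iff by metis+
    then show ?thesis
      using assms(4) xy by simp
  qed
  moreover have "f \<in> extensional (points S)" "g \<in> extensional (points S)"
    "\<sigma> \<in> extensional (rels S)" "\<rho> \<in> extensional (rels S)"
    using assms(2,3) by (auto simp: scheme_mor_iff PiE_def)
  ultimately show ?thesis
    using assms(4) by (blast intro: extensionalityI)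
qed

lemma scheme_mor_compose:
  assumes S: "relation_structure S" and f: "(f, \<sigma>) \<in> scheme_mor S T" and g: "(g, \<rho>) \<in> scheme_mor T U"
  shows "(compose (points S) g f, compose (rels S) \<rho> \<sigma>) \<in> scheme_mor S U"
  unfolding scheme_mor_iff
proof (intro conjI ballI)
  note fD = f[unfolded scheme_mor_iff] and gD = g[unfolded scheme_mor_iff]
  show "compose (points S) g f \<in> points S \<rightarrow>\<^sub>E points U" "compose (rels S) \<rho> \<sigma> \<in> rels S \<rightarrow>\<^sub>E rels U"
    using fD gD by (auto simp: compose_def)
  show "relmap U (compose (points S) g f x) (compose (points S) g f y) =
      compose (rels S) \<rho> \<sigma> (relmap S x y)" if xy: "x \<in> points S" "y \<in> points S" for x y
  proof -
    have "f x \<in> points T" "f y \<in> points T"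
      using fD xy by auto
    then have "relmap U (g (f x)) (g (f y)) = \<rho> (relmap T (f x) (f y))"
      using gD by blast
    also have "relmap T (f x) (f y) = \<sigma> (relmap S x y)"
      using fD xy by blast
    finally show ?thesis
      using xy relmap_in_rels[OF S xy] by (simp add: compose_def)
  qed
qed

lemma scheme_End_monoid:
  assumes S: "relation_structure S"
  shows "monoid (scheme_End S)"
proof (rule monoidI)
  show "\<phi> \<otimes>\<^bsub>scheme_End S\<^esub> \<psi> \<in> carrier (scheme_End S)"
    if "\<phi> \<in> carrier (scheme_End S)" "\<psi> \<in> carrier (scheme_End S)" for \<phi> \<psi>
    using that by (cases \<phi>; cases \<psi>) (simp add: scheme_End_def scheme_mor_compose[OF S])
  show "\<one>\<^bsub>scheme_End S\<^esub> \<in> carrier (scheme_End S)"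
    by (simp add: scheme_End_def scheme_mor_iff relmap_in_rels[OF S])
  show "\<phi> \<otimes>\<^bsub>scheme_End S\<^esub> \<psi> \<otimes>\<^bsub>scheme_End S\<^esub> \<chi> = \<phi> \<otimes>\<^bsub>scheme_End S\<^esub> (\<psi> \<otimes>\<^bsub>scheme_End S\<^esub> \<chi>)"
    if "\<phi> \<in> carrier (scheme_End S)" "\<psi> \<in> carrier (scheme_End S)" "\<chi> \<in> carrier (scheme_End S)"
    for \<phi> \<psi> \<chi>
  proof -
    obtain f \<sigma> g \<rho> h \<tau> where eq: "\<phi> = (f, \<sigma>)" "\<psi> = (g, \<rho>)" "\<chi> = (h, \<tau>)"
      by (metis surj_pair)
    then have "h \<in> points S \<rightarrow> points S" "\<tau> \<in> rels S \<rightarrow> rels S"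
      using that(3) by (simp_all add: scheme_End_def scheme_mor_iff PiE_def)
    then show ?thesis
      by (simp add: eq scheme_End_def
          compose_assoc[of h _ "points S"] compose_assoc[of \<tau> _ "rels S"])
  qed
  show "\<one>\<^bsub>scheme_End S\<^esub> \<otimes>\<^bsub>scheme_End S\<^esub> \<phi> = \<phi>" "\<phi> \<otimes>\<^bsub>scheme_End S\<^esub> \<one>\<^bsub>scheme_End S\<^esub> = \<phi>"
    if "\<phi> \<in> carrier (scheme_End S)" for \<phi>
  proof -
    obtain f \<sigma> where eq: "\<phi> = (f, \<sigma>)"
      by (metis surj_pair)
    then have "f \<in> points S \<rightarrow> points S" "\<sigma> \<in> rels S \<rightarrow> rels S"
      and "f \<in> extensional (points S)" "\<sigma> \<in> extensional (rels S)"
      using that by (simp_all add: scheme_End_def scheme_mor_iff PiE_def)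
    then show "\<one>\<^bsub>scheme_End S\<^esub> \<otimes>\<^bsub>scheme_End S\<^esub> \<phi> = \<phi>" "\<phi> \<otimes>\<^bsub>scheme_End S\<^esub> \<one>\<^bsub>scheme_End S\<^esub> = \<phi>"
      by (simp_all add: eq scheme_End_def)
  qed
qed

lemma scheme_Aut_group: "relation_structure S \<Longrightarrow> group (scheme_Aut S)"
  unfolding scheme_Aut_def by (intro monoid.units_group scheme_End_monoid)

lemma scheme_mult:
  "(g, \<rho>) \<otimes>\<^bsub>scheme_Aut S\<^esub> (f, \<sigma>) = (compose (points S) g f, compose (rels S) \<rho> \<sigma>)"
  by (simp add: scheme_Aut_def units_of_def scheme_End_def)

lemma fst_scheme_mult: "x \<in> points S \<Longrightarrow> fst (\<phi> \<otimes>\<^bsub>scheme_Aut S\<^esub> \<psi>) x = fst \<phi> (fst \<psi> x)"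
  by (cases \<phi>; cases \<psi>) (simp add: scheme_mult compose_def)

lemma scheme_one: "\<one>\<^bsub>scheme_Aut S\<^esub> = (\<lambda>x\<in>points S. x, \<lambda>i\<in>rels S. i)"
  by (simp add: scheme_Aut_def units_of_def scheme_End_def)

text \<open>
Invertibility need only be tested on points: if \<open>f\<close> is a permutation, every relation is attained at
a pair of images, so \<open>\<sigma>\<close> is a surjection of a finite set onto itself and hence bijective, and the
two inverse maps again form a morphism.
\<close>

lemma scheme_Aut_iff:
  assumes S: "relation_structure S"
  shows "(f, \<sigma>) \<in> carrier (scheme_Aut S) \<longleftrightarrow>
    (f, \<sigma>) \<in> scheme_mor S S \<and> bij_betw f (points S) (points S)"
proof
  assume "(f, \<sigma>) \<in> carrier (scheme_Aut S)"
  then obtain g \<rho> where f: "(f, \<sigma>) \<in> scheme_mor S S" and g: "(g, \<rho>) \<in> scheme_mor S S"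
    and eq: "compose (points S) g f = (\<lambda>x\<in>points S. x)" "compose (points S) f g = (\<lambda>x\<in>points S. x)"
    by (auto simp: scheme_Aut_def units_of_def Units_def scheme_End_def)
  have "g (f x) = x" "f (g x) = x" if "x \<in> points S" for x
    using that fun_cong[OF eq(1), of x] fun_cong[OF eq(2), of x] by (simp_all add: compose_def)
  then have "bij_betw f (points S) (points S)"
    by (intro bij_betw_byWitness[where f' = g]) (use f g in \<open>auto simp: scheme_mor_iff\<close>)
  then show "(f, \<sigma>) \<in> scheme_mor S S \<and> bij_betw f (points S) (points S)"
    using f by simp
next
  assume "(f, \<sigma>) \<in> scheme_mor S S \<and> bij_betw f (points S) (points S)"
  then have f: "(f, \<sigma>) \<in> scheme_mor S S" and bij: "bij_betw f (points S) (points S)" by auto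
  note fD = f[unfolded scheme_mor_iff]
  define g where "g = (\<lambda>x\<in>points S. inv_into (points S) f x)"
  define \<rho> where "\<rho> = (\<lambda>r\<in>rels S. inv_into (rels S) \<sigma> r)"
  have g: "g x \<in> points S" "f (g x) = x" "g (f x) = x" if "x \<in> points S" for x
    using that bij bij_betw_apply[OF bij that] bij_betw_apply[OF bij_betw_inv_into[OF bij] that]
    by (simp_all add: g_def bij_betw_inv_into_left bij_betw_inv_into_right)
  have "rels S \<subseteq> \<sigma> ` rels S"
  proof
    fix r assume "r \<in> rels S"
    then obtain x y where "x \<in> points S" "y \<in> points S" "relmap S x y = r"
      using S by (blast elim: rels_obtain)
    then have "r = \<sigma> (relmap S (g x) (g y))"
      using fD g by metis
    then show "r \<in> \<sigma> ` rels S"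
      using g \<open>x \<in> points S\<close> \<open>y \<in> points S\<close> relmap_in_rels[OF S] by blast
  qed
  moreover from this have "inj_on \<sigma> (rels S)"
    using S by (simp add: relation_structure_def finite_surj_inj)
  moreover have "\<sigma> ` rels S \<subseteq> rels S"
    using fD by auto
  ultimately have bij\<sigma>: "bij_betw \<sigma> (rels S) (rels S)"
    by (simp add: bij_betw_def)
  have \<rho>: "\<rho> x \<in> rels S" "\<sigma> (\<rho> x) = x" "\<rho> (\<sigma> x) = x" if "x \<in> rels S" for x
    using that bij_betw_apply[OF bij\<sigma> that] bij_betw_apply[OF bij_betw_inv_into[OF bij\<sigma>] that]
    by (simp_all add: \<rho>_def bij_betw_inv_into_left[OF bij\<sigma>] bij_betw_inv_into_right[OF bij\<sigma>])
  have "relmap S (g x) (g y) = \<rho> (relmap S x y)" if "x \<in> points S" "y \<in> points S" for x y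
    using fD that g \<rho> relmap_in_rels[OF S] by metis
  then have "(g, \<rho>) \<in> scheme_mor S S"
    using g \<rho> by (auto simp: scheme_mor_iff g_def \<rho>_def)
  moreover have "compose (points S) g f = (\<lambda>x\<in>points S. x)" "compose (points S) f g = (\<lambda>x\<in>points S. x)"
    "compose (rels S) \<rho> \<sigma> = (\<lambda>x\<in>rels S. x)" "compose (rels S) \<sigma> \<rho> = (\<lambda>x\<in>rels S. x)"
    using g \<rho> by (auto simp: compose_def)
  ultimately show "(f, \<sigma>) \<in> carrier (scheme_Aut S)"
    using f by (auto simp: scheme_Aut_def units_of_def Units_def scheme_End_def intro!: bexI[of _ "(g, \<rho>)"])
qed

lemma scheme_Aut_rels_bij:
  assumes S: "relation_structure S" and "(f, \<sigma>) \<in> carrier (scheme_Aut S)"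
  shows "bij_betw \<sigma> (rels S) (rels S)"
proof -
  obtain g \<rho> where "(f, \<sigma>) \<in> scheme_mor S S" "(g, \<rho>) \<in> scheme_mor S S"
    and eq: "compose (rels S) \<rho> \<sigma> = (\<lambda>x\<in>rels S. x)" "compose (rels S) \<sigma> \<rho> = (\<lambda>x\<in>rels S. x)"
    using assms by (auto simp: scheme_Aut_def units_of_def Units_def scheme_End_def)
  moreover have "\<rho> (\<sigma> x) = x" "\<sigma> (\<rho> x) = x" if "x \<in> rels S" for x
    using that fun_cong[OF eq(1), of x] fun_cong[OF eq(2), of x] by (simp_all add: compose_def)
  ultimately show ?thesis
    by (intro bij_betw_byWitness[where f' = \<rho>]) (auto simp: scheme_mor_iff)
qed

text \<open>
Every relation is attained at some pair of points, so the map on points determines the map on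
relations.
\<close>

lemma scheme_Aut_eqI:
  assumes S: "relation_structure S"
    and "\<phi> \<in> carrier (scheme_Aut S)" "\<psi> \<in> carrier (scheme_Aut S)"
    and "\<And>x. x \<in> points S \<Longrightarrow> fst \<phi> x = fst \<psi> x"
  shows "\<phi> = \<psi>"
proof -
  have "(fst \<phi>, snd \<phi>) = (fst \<psi>, snd \<psi>)"
  proof (rule scheme_mor_eqI[OF S])
    show "(fst \<phi>, snd \<phi>) \<in> scheme_mor S S" "(fst \<psi>, snd \<psi>) \<in> scheme_mor S S"
      using assms(2,3) scheme_Aut_iff[OF S, of "fst \<phi>" "snd \<phi>"]
        scheme_Aut_iff[OF S, of "fst \<psi>" "snd \<psi>"] by simp_all
  qed (rule assms(4))
  then show ?thesis
    by simp
qed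

lemma scheme_AutI:
  assumes S: "relation_structure S" "bij_betw f (points S) (points S)" "f \<in> extensional (points S)"
    "\<sigma> \<in> extensional (rels S)"
    "\<And>x y. x \<in> points S \<Longrightarrow> y \<in> points S \<Longrightarrow> relmap S (f x) (f y) = \<sigma> (relmap S x y)"
  shows "(f, \<sigma>) \<in> carrier (scheme_Aut S)"
proof -
  have f: "f x \<in> points S" if "x \<in> points S" for x
    using assms(2) that by (auto simp: bij_betw_def)
  have "\<sigma> r \<in> rels S" if "r \<in> rels S" for r
    using rels_obtain[OF S(1) that] assms(5) f relmap_in_rels[OF S(1)] by metis
  then show ?thesis
    using assms f by (auto simp: scheme_Aut_iff scheme_mor_iff PiE_iff)
qed

lemma scheme_AutD:
  assumes "relation_structure S" "\<phi> \<in> carrier (scheme_Aut S)"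
  shows "bij_betw (fst \<phi>) (points S) (points S)" "fst \<phi> \<in> extensional (points S)"
    "snd \<phi> \<in> extensional (rels S)" "bij_betw (snd \<phi>) (rels S) (rels S)"
    "\<And>x. x \<in> points S \<Longrightarrow> fst \<phi> x \<in> points S"
    "\<And>r. r \<in> rels S \<Longrightarrow> snd \<phi> r \<in> rels S"
    "\<And>x y. x \<in> points S \<Longrightarrow> y \<in> points S \<Longrightarrow> relmap S (fst \<phi> x) (fst \<phi> y) = snd \<phi> (relmap S x y)"
  using assms scheme_Aut_rels_bij[of S "fst \<phi>" "snd \<phi>"]
  by (cases \<phi>; auto simp: scheme_Aut_iff scheme_mor_iff PiE_iff)+


lemma scheme_Aut_map_eq_iff:
  assumes "relation_structure S" "\<phi> \<in> carrier (scheme_Aut S)" "x \<in> points S" "y \<in> points S"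
  shows "fst \<phi> x = fst \<phi> y \<longleftrightarrow> x = y"
  using bij_betw_imp_inj_on[OF scheme_AutD(1)[OF assms(1,2)]] assms(3,4) by (simp add: inj_on_eq_iff)

lemma scheme_Aut_obtain_preimage:
  assumes "relation_structure S" "\<phi> \<in> carrier (scheme_Aut S)" "x \<in> points S"
  obtains y where "y \<in> points S" "fst \<phi> y = x"
proof -
  have "x \<in> fst \<phi> ` points S"
    using bij_betw_imp_surj_on[OF scheme_AutD(1)[OF assms(1,2)]] assms(3) by simp
  then show ?thesis
    using that by auto
qed

section \<open>The fibers of a wreath product are permuted\<close>

locale wreath_pair =
  fixes X :: "('a, 'i) scheme" and Y :: "('b, 'j) scheme"
  assumes X: "assoc_scheme X" and Y: "assoc_scheme Y"
begin

abbreviation "W \<equiv> wreath X Y"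

lemma sX: "relation_structure X" and sY: "relation_structure Y" and sW: "relation_structure W"
  using X Y assoc_scheme_wreath assoc_scheme_relation_structure by blast+

lemma finite_points: "finite (points X)" "finite (points Y)" "finite (points W)"
  using X Y by (simp_all add: assoc_scheme_def wreath_def)

lemma points_W: "points W = points X \<times> points Y"
  and relmap_W: "relmap W (x, y) (x', y') =
      (if x = x' then Inr (relmap Y y y') else Inl (relmap X x x'))"
  by (simp_all add: wreath_def)

lemma relmap_W_same: "fst z = fst z' \<Longrightarrow> relmap W z z' = Inr (relmap Y (snd z) (snd z'))"
  and relmap_W_diff: "fst z \<noteq> fst z' \<Longrightarrow> relmap W z z' = Inl (relmap X (fst z) (fst z'))"
  by (cases z; cases z'; simp add: relmap_W)+

lemma points_X_obtain: obtains x where "x \<in> points X"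
  using rels_obtain[OF sX id_rel_props(1)[OF X]] by blast

lemma points_Y_obtain: obtains y where "y \<in> points Y"
  using rels_obtain[OF sY id_rel_props(1)[OF Y]] by blast

lemma fiber_eq: "x \<in> points X \<Longrightarrow> fiber X Y x = {x} \<times> points Y"
  by (auto simp: fiber_def points_W)

text \<open>
The counting argument. Write \<open>f\<close> for the action of \<open>\<phi>\<close> on points. With \<open>u\<close> the base point below \<open>f (x, y')\<close>, all points over \<open>u\<close> have the same
relation to \<open>f (x, y)\<close>, hence their preimages have the same relation to \<open>(x, y)\<close> as \<open>(x, y')\<close> does
and lie over \<open>x\<close>. Together with \<open>(x, y)\<close> itself these are \<open>card (points Y) + 1\<close> points over \<open>x\<close>.
\<close>

lemma aut_respects_fibers:
  assumes \<phi>: "\<phi> \<in> carrier (scheme_Aut W)" and x: "x \<in> points X"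
    and y: "y \<in> points Y" and y': "y' \<in> points Y"
  shows "fst (fst \<phi> (x, y)) = fst (fst \<phi> (x, y'))"
proof (rule ccontr)
  assume neq: "fst (fst \<phi> (x, y)) \<noteq> fst (fst \<phi> (x, y'))"
  define f where "f = fst \<phi>"
  define z where "z = (x, y)"
  define u where "u = fst (f (x, y'))"
  have z: "z \<in> points W" "(x, y') \<in> points W"
    using x y y' by (auto simp: z_def points_W)
  have f: "f q \<in> points W" if "q \<in> points W" for q
    using scheme_AutD(5)[OF sW \<phi> that] by (simp add: f_def)
  have u: "u \<in> points X" "fst (f z) \<noteq> u"
    using f[OF z(2)] neq by (auto simp: u_def z_def f_def points_W)
  have "(u, w) \<in> f ` ({x} \<times> points Y)" if w: "w \<in> points Y" for w
  proof -
    obtain q where q: "q \<in> points W" "f q = (u, w)"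
      using scheme_Aut_obtain_preimage[OF sW \<phi>, of "(u, w)"] u w by (auto simp: f_def points_W)
    have "relmap W (f z) (f q) = relmap W (f z) (f (x, y'))"
      using u(2) q(2) by (simp add: relmap_W_diff u_def)
    then have "snd \<phi> (relmap W z q) = snd \<phi> (relmap W z (x, y'))"
      using scheme_AutD(7)[OF sW \<phi>] z q(1) by (simp add: f_def)
    then have "relmap W z q = relmap W z (x, y')"
      using bij_betw_imp_inj_on[OF scheme_AutD(4)[OF sW \<phi>]] relmap_in_rels[OF sW] z q(1)
      by (simp add: inj_on_eq_iff)
    then have "fst q = x"
      by (cases q) (simp add: z_def relmap_W split: if_splits)
    then have "q \<in> {x} \<times> points Y"
      using q(1) by (cases q) (simp add: points_W)
    then show ?thesis
      using q(2) by (metis imageI)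
  qed
  then have "insert (f z) ({u} \<times> points Y) \<subseteq> f ` ({x} \<times> points Y)"
    using y by (auto simp: z_def)
  then have "card (insert (f z) ({u} \<times> points Y)) \<le> card (f ` ({x} \<times> points Y))"
    using finite_points by (intro card_mono) auto
  also have "\<dots> \<le> card ({x} \<times> points Y)"
    using finite_points by (intro card_image_le) auto
  finally have "card (insert (f z) ({u} \<times> points Y)) \<le> card (points Y)"
    by (simp add: card_cartesian_product)
  moreover have "f z \<notin> {u} \<times> points Y"
    using u(2) by auto
  ultimately show False
    using finite_points by (simp add: card_cartesian_product)
qed

text \<open>
By \<open>aut_respects_fibers\<close> the choice of the point of \<open>Y\<close> is immaterial.
\<close>

definition base_map :: "('a \<times> 'b \<Rightarrow> 'a \<times> 'b) \<times> ('i + 'j \<Rightarrow> 'i + 'j) \<Rightarrow> 'a \<Rightarrow> 'a" where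
  "base_map \<phi> = (\<lambda>x\<in>points X. fst (fst \<phi> (x, SOME y. y \<in> points Y)))"

text \<open>
The identity relation of \<open>X\<close> has no counterpart among the relations of the wreath product, so its
image has to be supplied by hand.
\<close>

definition base_rel :: "('a \<times> 'b \<Rightarrow> 'a \<times> 'b) \<times> ('i + 'j \<Rightarrow> 'i + 'j) \<Rightarrow> 'i \<Rightarrow> 'i" where
  "base_rel \<phi> = (\<lambda>i\<in>rels X. if i = id_rel X then id_rel X else projl (snd \<phi> (Inl i)))"

lemma fst_aut:
  assumes \<phi>: "\<phi> \<in> carrier (scheme_Aut W)" and z: "z \<in> points W"
  shows "fst (fst \<phi> z) = base_map \<phi> (fst z)"
proof -
  let ?y = "SOME y. y \<in> points Y"
  have zXY: "fst z \<in> points X" "snd z \<in> points Y"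
    using z by (auto simp: points_W)
  then have "?y \<in> points Y"
    by (intro someI[of "\<lambda>y. y \<in> points Y"])
  then have "fst (fst \<phi> (fst z, snd z)) = fst (fst \<phi> (fst z, ?y))"
    by (intro aut_respects_fibers[OF \<phi> zXY])
  then show ?thesis
    using zXY by (simp add: base_map_def)
qed

lemma base_map_bij:
  assumes \<phi>: "\<phi> \<in> carrier (scheme_Aut W)"
  shows "bij_betw (base_map \<phi>) (points X) (points X)"
proof -
  obtain y where y: "y \<in> points Y"
    by (rule points_Y_obtain)
  have "points X \<subseteq> base_map \<phi> ` points X"
  proof
    fix x assume "x \<in> points X"
    then obtain z where z: "z \<in> points W" "fst \<phi> z = (x, y)"
      using scheme_Aut_obtain_preimage[OF sW \<phi>, of "(x, y)"] y by (auto simp: points_W)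
    then have "x = base_map \<phi> (fst z)"
      using fst_aut[OF \<phi> z(1)] by simp
    then show "x \<in> base_map \<phi> ` points X"
      using z(1) by (auto simp: points_W)
  qed
  moreover have "base_map \<phi> ` points X \<subseteq> points X"
  proof
    fix x assume "x \<in> base_map \<phi> ` points X"
    then obtain u where u: "u \<in> points X" "x = base_map \<phi> u" by blast
    then show "x \<in> points X"
      using fst_aut[OF \<phi>, of "(u, y)"] scheme_AutD(5)[OF sW \<phi>, of "(u, y)"] y
      by (auto simp: points_W mem_Times_iff)
  qed
  ultimately show ?thesis
    using finite_surj_inj[OF finite_points(1)] by (auto simp: bij_betw_def)
qed

lemma aut_maps_fiber:
  assumes \<phi>: "\<phi> \<in> carrier (scheme_Aut W)" and x: "x \<in> points X"
  shows "fst \<phi> ` fiber X Y x = fiber X Y (base_map \<phi> x)"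
proof
  show "fst \<phi> ` fiber X Y x \<subseteq> fiber X Y (base_map \<phi> x)"
    using scheme_AutD(5)[OF sW \<phi>] fst_aut[OF \<phi>] by (auto simp: fiber_def)
  show "fiber X Y (base_map \<phi> x) \<subseteq> fst \<phi> ` fiber X Y x"
  proof
    fix z assume z: "z \<in> fiber X Y (base_map \<phi> x)"
    then have "z \<in> points W"
      by (simp add: fiber_def)
    then obtain q where q: "q \<in> points W" "fst \<phi> q = z"
      by (rule scheme_Aut_obtain_preimage[OF sW \<phi>])
    then have "base_map \<phi> (fst q) = base_map \<phi> x" "fst q \<in> points X"
      using z fst_aut[OF \<phi> q(1)] by (auto simp: fiber_def points_W)
    then have "fst q = x"
      using bij_betw_imp_inj_on[OF base_map_bij[OF \<phi>]] x by (simp add: inj_on_eq_iff)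
    then show "z \<in> fst \<phi> ` fiber X Y x"
      using q by (auto simp: fiber_def)
  qed
qed

text \<open>
Over distinct base points the relation in the wreath product is the \<open>Inl\<close> of the relation in \<open>X\<close>,
both before and after applying the automorphism, since \<open>base_map\<close> is injective.
\<close>

lemma base_aut:
  assumes \<phi>: "\<phi> \<in> carrier (scheme_Aut W)"
  shows "(base_map \<phi>, base_rel \<phi>) \<in> carrier (scheme_Aut X)"
proof (rule scheme_AutI[OF sX base_map_bij[OF \<phi>]])
  fix x x' assume x: "x \<in> points X" "x' \<in> points X"
  have b: "base_map \<phi> x \<in> points X" "base_map \<phi> x' \<in> points X"
    using bij_betw_apply[OF base_map_bij[OF \<phi>]] x by auto
  show "relmap X (base_map \<phi> x) (base_map \<phi> x') = base_rel \<phi> (relmap X x x')"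
  proof (cases "x = x'")
    case True
    then have "relmap X x x' = id_rel X" "relmap X (base_map \<phi> x) (base_map \<phi> x') = id_rel X"
      using id_rel_props(3)[OF X] x b by auto
    then show ?thesis
      using id_rel_props(1)[OF X] by (simp add: base_rel_def)
  next
    case False
    obtain y where "y \<in> points Y"
      by (rule points_Y_obtain)
    then have W: "(x, y) \<in> points W" "(x', y) \<in> points W"
      using x by (auto simp: points_W)
    have "base_map \<phi> x \<noteq> base_map \<phi> x'"
      using False bij_betw_imp_inj_on[OF base_map_bij[OF \<phi>]] x by (simp add: inj_on_eq_iff)
    then have "Inl (relmap X (base_map \<phi> x) (base_map \<phi> x')) =
        relmap W (fst \<phi> (x, y)) (fst \<phi> (x', y))"
      using fst_aut[OF \<phi>] W by (simp add: relmap_W_diff)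
    also have "\<dots> = snd \<phi> (Inl (relmap X x x'))"
      using scheme_AutD(7)[OF sW \<phi>] W False by (simp add: relmap_W)
    finally have "relmap X (base_map \<phi> x) (base_map \<phi> x') = projl (snd \<phi> (Inl (relmap X x x')))"
      by (metis sum.sel(1))
    then show ?thesis
      using False id_rel_props(3)[OF X] x relmap_in_rels[OF sX] by (simp add: base_rel_def)
  qed
qed (simp_all add: base_map_def base_rel_def)

lemma base_map_unique:
  assumes \<phi>: "\<phi> \<in> carrier (scheme_Aut W)"
  shows "g \<in> carrier (BijGroup (points X)) \<and> (\<forall>z\<in>points W. fst (fst \<phi> z) = g (fst z)) \<longleftrightarrow>
    g = base_map \<phi>"
proof
  assume g: "g \<in> carrier (BijGroup (points X)) \<and> (\<forall>z\<in>points W. fst (fst \<phi> z) = g (fst z))"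
  obtain y where y: "y \<in> points Y"
    by (rule points_Y_obtain)
  have "g x = base_map \<phi> x" if "x \<in> points X" for x
    using g fst_aut[OF \<phi>, of "(x, y)"] that y by (force simp: points_W)
  then show "g = base_map \<phi>"
    using g by (auto simp: BijGroup_def Bij_def base_map_def intro!: extensionalityI[of g "points X"])
next
  assume "g = base_map \<phi>"
  then show "g \<in> carrier (BijGroup (points X)) \<and> (\<forall>z\<in>points W. fst (fst \<phi> z) = g (fst z))"
    using base_map_bij[OF \<phi>] fst_aut[OF \<phi>] by (simp add: BijGroup_def Bij_def base_map_def)
qed

lemma induced_bij_eq:
  "\<phi> \<in> carrier (scheme_Aut W) \<Longrightarrow> induced_bij X Y (fst \<phi>) = base_map \<phi>"
  unfolding induced_bij_def by (simp add: base_map_unique)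

lemma base_aut_unique:
  assumes \<phi>: "\<phi> \<in> carrier (scheme_Aut W)"
  shows "\<psi> \<in> carrier (scheme_Aut X) \<and> fst \<psi> = induced_bij X Y (fst \<phi>) \<longleftrightarrow>
    \<psi> = (base_map \<phi>, base_rel \<phi>)"
  using base_aut[OF \<phi>] scheme_Aut_eqI[OF sX, of \<psi> "(base_map \<phi>, base_rel \<phi>)"]
  by (auto simp: induced_bij_eq[OF \<phi>])

section \<open>The projection to the base and its splitting\<close>

lemma wreath_P_eq: "\<phi> \<in> carrier (scheme_Aut W) \<Longrightarrow> wreath_P X Y \<phi> = (base_map \<phi>, base_rel \<phi>)"
  unfolding wreath_P_def by (simp add: case_prod_unfold base_aut_unique)

lemma wreath_P_closed: "\<phi> \<in> carrier (scheme_Aut W) \<Longrightarrow> wreath_P X Y \<phi> \<in> carrier (scheme_Aut X)"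
  by (simp add: wreath_P_eq base_aut)

lemma fst_wreath_P:
  "\<phi> \<in> carrier (scheme_Aut W) \<Longrightarrow> z \<in> points W \<Longrightarrow> fst (fst \<phi> z) = fst (wreath_P X Y \<phi>) (fst z)"
  by (simp add: wreath_P_eq fst_aut)

lemma wreath_P_eqI:
  assumes \<phi>: "\<phi> \<in> carrier (scheme_Aut W)" and a: "a \<in> carrier (scheme_Aut X)"
    and eq: "\<And>z. z \<in> points W \<Longrightarrow> fst (fst \<phi> z) = fst a (fst z)"
  shows "wreath_P X Y \<phi> = a"
proof (rule scheme_Aut_eqI[OF sX wreath_P_closed[OF \<phi>] a])
  fix x assume x: "x \<in> points X"
  obtain y where "y \<in> points Y"
    by (rule points_Y_obtain)
  then show "fst (wreath_P X Y \<phi>) x = fst a x"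
    using eq[of "(x, y)"] fst_wreath_P[OF \<phi>, of "(x, y)"] x by (simp add: points_W)
qed

lemma group_W: "group (scheme_Aut W)" and group_X: "group (scheme_Aut X)"
  and group_Y: "group (scheme_Aut Y)"
  using scheme_Aut_group sW sX sY by blast+

lemma wreath_P_hom: "group_hom (scheme_Aut W) (scheme_Aut X) (wreath_P X Y)"
proof -
  interpret W: group "scheme_Aut W" by (rule group_W)
  interpret X: group "scheme_Aut X" by (rule group_X)
  have "wreath_P X Y (\<phi> \<otimes>\<^bsub>scheme_Aut W\<^esub> \<psi>) = wreath_P X Y \<phi> \<otimes>\<^bsub>scheme_Aut X\<^esub> wreath_P X Y \<psi>"
    if "\<phi> \<in> carrier (scheme_Aut W)" "\<psi> \<in> carrier (scheme_Aut W)" for \<phi> \<psi>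
  proof (rule wreath_P_eqI)
    fix z assume z: "z \<in> points W"
    have "fst z \<in> points X"
      using z by (auto simp: points_W)
    then show "fst (fst (\<phi> \<otimes>\<^bsub>scheme_Aut W\<^esub> \<psi>) z) =
        fst (wreath_P X Y \<phi> \<otimes>\<^bsub>scheme_Aut X\<^esub> wreath_P X Y \<psi>) (fst z)"
      using that z scheme_AutD(5)[OF sW that(2) z] by (simp add: fst_scheme_mult fst_wreath_P)
  qed (use that in \<open>simp_all add: wreath_P_closed\<close>)
  then show ?thesis
    by unfold_locales (simp add: hom_def wreath_P_closed)
qed

lemma fst_split: "z \<in> points W \<Longrightarrow> fst (wreath_split X Y a) z = (fst a (fst z), snd z)"
  by (cases a; cases z) (simp add: wreath_split_def)

text \<open>
The permutation of the base is injective, so points in different fibers stay in different fibers;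
this is what makes the action on \<open>Inl\<close> relations consistent.
\<close>

lemma wreath_split_closed:
  assumes a: "a \<in> carrier (scheme_Aut X)"
  shows "wreath_split X Y a \<in> carrier (scheme_Aut W)"
proof -
  have "bij_betw (\<lambda>z. (fst a (fst z), snd z)) (points X \<times> points Y) (points X \<times> points Y)"
    using scheme_AutD(1)[OF sX a] by (auto simp: bij_betw_def inj_on_def image_iff) (metis imageE)+
  then have "bij_betw (fst (wreath_split X Y a)) (points W) (points W)"
    by (subst bij_betw_cong[OF fst_split]) (simp_all add: points_W)
  then have "(fst (wreath_split X Y a), snd (wreath_split X Y a)) \<in> carrier (scheme_Aut W)"
  proof (rule scheme_AutI[OF sW])
    fix z z' assume z: "z \<in> points W" "z' \<in> points W"
    then have x: "fst z \<in> points X" "fst z' \<in> points X"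
      by (auto simp: points_W)
    have "snd (wreath_split X Y a) (relmap W z z') = map_sum (snd a) id (relmap W z z')"
      using relmap_in_rels[OF sW z] by (cases a) (simp add: wreath_split_def)
    then show "relmap W (fst (wreath_split X Y a) z) (fst (wreath_split X Y a) z') =
        snd (wreath_split X Y a) (relmap W z z')"
      using scheme_AutD(7)[OF sX a x] scheme_Aut_map_eq_iff[OF sX a x] z
      by (cases "fst z = fst z'") (simp_all add: fst_split relmap_W_same relmap_W_diff)
  qed (cases a; simp add: wreath_split_def)+
  then show ?thesis
    by simp
qed

lemma wreath_split_hom: "wreath_split X Y \<in> hom (scheme_Aut X) (scheme_Aut W)"
proof -
  interpret W: group "scheme_Aut W" by (rule group_W)
  interpret X: group "scheme_Aut X" by (rule group_X)
  show ?thesis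
  proof (rule homI[OF wreath_split_closed])
    fix a b assume ab: "a \<in> carrier (scheme_Aut X)" "b \<in> carrier (scheme_Aut X)"
    show "wreath_split X Y (a \<otimes>\<^bsub>scheme_Aut X\<^esub> b) =
        wreath_split X Y a \<otimes>\<^bsub>scheme_Aut W\<^esub> wreath_split X Y b"
    proof (rule scheme_Aut_eqI[OF sW])
      fix z assume z: "z \<in> points W"
      then have "(fst b (fst z), snd z) \<in> points W"
        using scheme_AutD(5)[OF sX ab(2)] by (auto simp: points_W)
      then show "fst (wreath_split X Y (a \<otimes>\<^bsub>scheme_Aut X\<^esub> b)) z =
          fst (wreath_split X Y a \<otimes>\<^bsub>scheme_Aut W\<^esub> wreath_split X Y b) z"
        using z by (simp add: fst_scheme_mult fst_split) (auto simp: fst_scheme_mult points_W)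
    qed (use ab in \<open>simp_all add: wreath_split_closed\<close>)
  qed
qed

lemma wreath_P_split:
  assumes a: "a \<in> carrier (scheme_Aut X)"
  shows "wreath_P X Y (wreath_split X Y a) = a"
  by (rule wreath_P_eqI[OF wreath_split_closed[OF a] a]) (simp add: fst_split)

sublocale ext: split_extension "scheme_Aut W" "scheme_Aut X" "wreath_P X Y" "wreath_split X Y"
  by (rule split_extension.intro[OF wreath_P_hom])
    (simp add: split_extension_axioms_def wreath_split_hom wreath_P_split)

lemma wreath_act_eq: "wreath_act X Y = ext.conj_act"
  by (simp add: wreath_act_def wreath_K_def fun_eq_iff)

section \<open>The kernel: one automorphism per fiber\<close>

lemma mult_K: "k \<otimes>\<^bsub>wreath_K X Y\<^esub> l = k \<otimes>\<^bsub>scheme_Aut W\<^esub> l"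
  by (simp add: wreath_K_def)

text \<open>
From here on this replaces the definition of the kernel through \<open>wreath_P\<close>, in which the induced
automorphism is given by a description operator.
\<close>

lemma carrier_K: "k \<in> carrier (wreath_K X Y) \<longleftrightarrow>
    k \<in> carrier (scheme_Aut W) \<and> (\<forall>z\<in>points W. fst (fst k z) = fst z)"
proof -
  have "wreath_P X Y k = \<one>\<^bsub>scheme_Aut X\<^esub> \<longleftrightarrow> (\<forall>z\<in>points W. fst (fst k z) = fst z)"
    if k: "k \<in> carrier (scheme_Aut W)"
  proof -
    have one: "fst \<one>\<^bsub>scheme_Aut X\<^esub> (fst z) = fst z" if "z \<in> points W" for z
      using that by (auto simp: scheme_one points_W)
    then show ?thesis
      using wreath_P_eqI[OF k ext.H.one_closed] fst_wreath_P[OF k] by metis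
  qed
  then show ?thesis
    by (auto simp: wreath_K_def kernel_def)
qed

lemma group_K: "group (wreath_K X Y)"
  unfolding wreath_K_def by (intro subgroup.subgroup_is_group ext.subgroup_kernel group_W)

lemma fiber_scheme_simps [simp]:
  "points (fiber_scheme X Y x) = fiber X Y x" "rels (fiber_scheme X Y x) = rels Y"
  "relmap (fiber_scheme X Y x) z z' = relmap Y (snd z) (snd z')"
  by (simp_all add: fiber_scheme_def)

lemma sF:
  assumes x: "x \<in> points X"
  shows "relation_structure (fiber_scheme X Y x)"
proof -
  have "(\<lambda>(z, z'). relmap Y (snd z) (snd z')) ` (fiber X Y x \<times> fiber X Y x) =
      (\<lambda>(y, y'). relmap Y y y') ` (points Y \<times> points Y)"
    by (force simp: fiber_eq[OF x] image_iff)
  then show ?thesis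
    using sY by (simp add: relation_structure_def)
qed

lemma fst_restrict: "x \<in> points X \<Longrightarrow> z \<in> fiber X Y x \<Longrightarrow> fst (wreath_restrict X Y k x) z = fst k z"
  by (simp add: wreath_restrict_def case_prod_unfold)

text \<open>
A fiber-preserving injection permutes each fiber, as fibers are finite, and the relation of two
points of a fiber is read off from its \<open>Inr\<close> in the wreath product.
\<close>

lemma wreath_restrict_closed:
  assumes k: "k \<in> carrier (wreath_K X Y)" and x: "x \<in> points X"
  shows "wreath_restrict X Y k x \<in> carrier (scheme_Aut (fiber_scheme X Y x))"
proof -
  have kW: "k \<in> carrier (scheme_Aut W)" and fk: "\<And>z. z \<in> points W \<Longrightarrow> fst (fst k z) = fst z"
    using k by (auto simp: carrier_K)
  have sub: "fiber X Y x \<subseteq> points W"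
    by (auto simp: fiber_def)
  have inj: "inj_on (fst k) (fiber X Y x)"
    using bij_betw_imp_inj_on[OF scheme_AutD(1)[OF sW kW]] sub by (rule inj_on_subset)
  have into: "fst k ` fiber X Y x \<subseteq> fiber X Y x"
    using fk scheme_AutD(5)[OF sW kW] by (auto simp: fiber_def)
  have "bij_betw (fst k) (fiber X Y x) (fiber X Y x)"
    using inj endo_inj_surj[OF finite_subset[OF sub finite_points(3)] into inj]
    by (simp add: bij_betw_def)
  then have "bij_betw (restrict (fst k) (fiber X Y x)) (fiber X Y x) (fiber X Y x)"
    by (subst bij_betw_cong[where g = "fst k"]) simp_all
  moreover have "relmap Y (snd (fst k z)) (snd (fst k z')) = projr (snd k (Inr (relmap Y (snd z) (snd z'))))"
    if "z \<in> fiber X Y x" "z' \<in> fiber X Y x" for z z'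
  proof -
    have z: "z \<in> points W" "z' \<in> points W" "fst z = fst z'"
      using that by (auto simp: fiber_def)
    then have "Inr (relmap Y (snd (fst k z)) (snd (fst k z'))) = snd k (Inr (relmap Y (snd z) (snd z')))"
      using scheme_AutD(7)[OF sW kW z(1,2)] fk by (simp add: relmap_W_same)
    then show ?thesis
      by (metis sum.sel(2))
  qed
  moreover have "relmap Y (snd z) (snd z') \<in> rels Y" if "z \<in> fiber X Y x" "z' \<in> fiber X Y x" for z z'
    using relmap_in_rels[OF sY] that x by (auto simp: fiber_eq)
  ultimately show ?thesis
    using x by (auto simp: wreath_restrict_def case_prod_unfold intro!: scheme_AutI[OF sF])
qed

lemma wreath_restrict_PiE:
  "k \<in> carrier (wreath_K X Y) \<Longrightarrow>
    wreath_restrict X Y k \<in> (\<Pi>\<^sub>E x\<in>points X. carrier (scheme_Aut (fiber_scheme X Y x)))"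
  using wreath_restrict_closed by (auto simp: PiE_iff) (simp add: wreath_restrict_def case_prod_unfold)

lemma group_fibers: "group (product_group (points X) (\<lambda>x. scheme_Aut (fiber_scheme X Y x)))"
  by (intro product_group scheme_Aut_group sF)

lemma wreath_restrict_hom:
  "group_hom (wreath_K X Y) (product_group (points X) (\<lambda>x. scheme_Aut (fiber_scheme X Y x)))
     (wreath_restrict X Y)"
proof -
  interpret K: group "wreath_K X Y" by (rule group_K)
  have "wreath_restrict X Y (k \<otimes>\<^bsub>wreath_K X Y\<^esub> l) = (\<lambda>x\<in>points X.
      wreath_restrict X Y k x \<otimes>\<^bsub>scheme_Aut (fiber_scheme X Y x)\<^esub> wreath_restrict X Y l x)"
    if kl: "k \<in> carrier (wreath_K X Y)" "l \<in> carrier (wreath_K X Y)" for k l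
  proof (rule extensionalityI[of _ "points X"])
    fix x assume x: "x \<in> points X"
    interpret F: group "scheme_Aut (fiber_scheme X Y x)"
      using scheme_Aut_group sF x by blast
    have "wreath_restrict X Y (k \<otimes>\<^bsub>wreath_K X Y\<^esub> l) x =
      wreath_restrict X Y k x \<otimes>\<^bsub>scheme_Aut (fiber_scheme X Y x)\<^esub> wreath_restrict X Y l x"
    proof (rule scheme_Aut_eqI[OF sF[OF x]])
      fix z assume "z \<in> points (fiber_scheme X Y x)"
      then have z: "z \<in> fiber X Y x" "z \<in> points W"
        by (auto simp: fiber_def)
      then have "fst l z \<in> fiber X Y x"
        using kl(2) scheme_AutD(5)[OF sW _ z(2)] by (auto simp: fiber_def carrier_K)
      then show "fst (wreath_restrict X Y (k \<otimes>\<^bsub>wreath_K X Y\<^esub> l) x) z =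
          fst (wreath_restrict X Y k x \<otimes>\<^bsub>scheme_Aut (fiber_scheme X Y x)\<^esub> wreath_restrict X Y l x) z"
        using x z by (simp add: fst_scheme_mult fst_restrict mult_K)
    qed (use kl x in \<open>simp_all add: wreath_restrict_closed\<close>)
    then show "wreath_restrict X Y (k \<otimes>\<^bsub>wreath_K X Y\<^esub> l) x = (\<lambda>x\<in>points X.
        wreath_restrict X Y k x \<otimes>\<^bsub>scheme_Aut (fiber_scheme X Y x)\<^esub> wreath_restrict X Y l x) x"
      using x by simp
  qed (simp_all add: wreath_restrict_def case_prod_unfold)
  then have "wreath_restrict X Y \<in>
      hom (wreath_K X Y) (product_group (points X) (\<lambda>x. scheme_Aut (fiber_scheme X Y x)))"
    using wreath_restrict_PiE by (simp add: hom_def)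
  then show ?thesis
    by (simp add: group_hom_def group_hom_axioms_def group_K group_fibers)
qed

text \<open>
The fibers cover the points, so restriction to all fibers loses nothing.
\<close>

lemma K_eqI:
  assumes "k \<in> carrier (wreath_K X Y)" "l \<in> carrier (wreath_K X Y)"
    and "wreath_restrict X Y k = wreath_restrict X Y l"
  shows "k = l"
proof (rule scheme_Aut_eqI[OF sW])
  fix z assume z: "z \<in> points W"
  then have "fst z \<in> points X" "z \<in> fiber X Y (fst z)"
    by (auto simp: points_W fiber_def)
  then show "fst k z = fst l z"
    using fst_restrict assms(3) by metis
qed (use assms in \<open>auto simp: carrier_K\<close>)

lemma fst_glue: "z \<in> points W \<Longrightarrow> fst (wreath_glue X Y \<tau> k) z = fst (k (fst z)) z"
  by (simp add: wreath_glue_def)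

text \<open>
The common relation component \<open>\<tau>\<close> is essential here: pairs within any fiber are all named
\<open>Inr j\<close>, so their images must be governed by one permutation of \<open>rels Y\<close>. Pairs from different
fibers keep their first coordinates, hence their relation.
\<close>

lemma wreath_glue_closed:
  assumes k: "k \<in> (\<Pi>\<^sub>E x\<in>points X. scheme_Aut_over (fiber_scheme X Y x) \<tau>)"
  shows "wreath_glue X Y \<tau> k \<in> carrier (wreath_K X Y)"
proof -
  let ?f = "\<lambda>z. fst (k (fst z)) z"
  have kx: "k x \<in> carrier (scheme_Aut (fiber_scheme X Y x))" "snd (k x) = \<tau>" if "x \<in> points X" for x
    using k that by (auto simp: scheme_Aut_over_def)
  have f: "?f z \<in> points W" "fst (?f z) = fst z" if z: "z \<in> points W" for z
  proof -
    have "fst z \<in> points X" "z \<in> fiber X Y (fst z)"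
      using z by (auto simp: points_W fiber_def)
    then have "?f z \<in> fiber X Y (fst z)"
      using scheme_AutD(5)[OF sF kx(1)] by simp
    then show "?f z \<in> points W" "fst (?f z) = fst z"
      by (auto simp: fiber_def)
  qed
  have "inj_on ?f (points W)"
  proof (rule inj_onI)
    fix z z' assume z: "z \<in> points W" "z' \<in> points W" and eq: "?f z = ?f z'"
    then have same: "fst z = fst z'"
      using f by metis
    then have "fst z \<in> points X" "z \<in> fiber X Y (fst z)" "z' \<in> fiber X Y (fst z)"
      using z by (auto simp: points_W fiber_def)
    then show "z = z'"
      using scheme_Aut_map_eq_iff[OF sF kx(1)] eq same by simp
  qed
  then have "bij_betw ?f (points W) (points W)"
    using endo_inj_surj[OF finite_points(3)] f(1) by (auto simp: bij_betw_def image_subset_iff)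
  then have "bij_betw (fst (wreath_glue X Y \<tau> k)) (points W) (points W)"
    by (subst bij_betw_cong[OF fst_glue]) simp_all
  then have "(fst (wreath_glue X Y \<tau> k), snd (wreath_glue X Y \<tau> k)) \<in> carrier (scheme_Aut W)"
  proof (rule scheme_AutI[OF sW])
    fix z z' assume z: "z \<in> points W" "z' \<in> points W"
    have "relmap W (?f z) (?f z') = map_sum id \<tau> (relmap W z z')"
    proof (cases "fst z = fst z'")
      case True
      then have "fst z \<in> points X" "z \<in> fiber X Y (fst z)" "z' \<in> fiber X Y (fst z)"
        using z by (auto simp: points_W fiber_def)
      then have rel: "relmap Y (snd (?f z)) (snd (?f z')) = \<tau> (relmap Y (snd z) (snd z'))"
        using scheme_AutD(7)[OF sF kx(1)] kx(2) True by simp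
      have "fst (?f z) = fst (?f z')"
        using f(2)[OF z(1)] f(2)[OF z(2)] True by metis
      then show ?thesis
        by (simp only: relmap_W_same[OF True] relmap_W_same rel map_sum.simps)
    next
      case False
      then show ?thesis
        using f z by (simp add: relmap_W_diff)
    qed
    then show "relmap W (fst (wreath_glue X Y \<tau> k) z) (fst (wreath_glue X Y \<tau> k) z') =
        snd (wreath_glue X Y \<tau> k) (relmap W z z')"
      using relmap_in_rels[OF sW z] z by (simp add: wreath_glue_def)
  qed (simp_all add: wreath_glue_def)
  then show ?thesis
    using f(2) by (simp add: carrier_K fst_glue)
qed

lemma wreath_restrict_glue:
  assumes k: "k \<in> (\<Pi>\<^sub>E x\<in>points X. scheme_Aut_over (fiber_scheme X Y x) \<tau>)"
  shows "wreath_restrict X Y (wreath_glue X Y \<tau> k) = k"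
proof (rule extensionalityI[of _ "points X"])
  show "wreath_restrict X Y (wreath_glue X Y \<tau> k) x = k x" if x: "x \<in> points X" for x
  proof (rule scheme_Aut_eqI[OF sF[OF x]])
    fix z assume "z \<in> points (fiber_scheme X Y x)"
    then have "z \<in> fiber X Y x" "z \<in> points W" "fst z = x"
      by (auto simp: fiber_def)
    then show "fst (wreath_restrict X Y (wreath_glue X Y \<tau> k) x) z = fst (k x) z"
      using x by (simp add: fst_restrict fst_glue)
  qed (use k x in \<open>auto simp: scheme_Aut_over_def wreath_restrict_closed[OF wreath_glue_closed[OF k]]\<close>)
qed (use k in \<open>auto simp: PiE_iff wreath_restrict_def case_prod_unfold\<close>)

text \<open>
Dropping the constant first coordinate turns an automorphism of a fiber into one of \<open>Y\<close> with the
same relation component. Hence the relation components that occur in the kernel all come from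
\<open>scheme_Aut Y\<close>.
\<close>

lemma fiber_aut_rel:
  assumes x: "x \<in> points X" and \<phi>: "\<phi> \<in> carrier (scheme_Aut (fiber_scheme X Y x))"
  shows "snd \<phi> \<in> snd ` carrier (scheme_Aut Y)"
proof -
  define h where "h = (\<lambda>y\<in>points Y. snd (fst \<phi> (x, y)))"
  note F = scheme_AutD[OF sF[OF x] \<phi>, simplified, unfolded fiber_eq[OF x]]
  have hx: "fst \<phi> (x, y) = (x, h y)" if "y \<in> points Y" for y
    using F(5)[of "(x, y)"] that by (auto simp: h_def prod_eq_iff mem_Times_iff)
  have h: "h y \<in> points Y" if "y \<in> points Y" for y
    using F(5)[of "(x, y)"] hx that by simp
  have "inj_on h (points Y)"
    using bij_betw_imp_inj_on[OF F(1)] hx by (force simp: inj_on_def)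
  then have "bij_betw h (points Y) (points Y)"
    using endo_inj_surj[OF finite_points(2)] h by (auto simp: bij_betw_def image_subset_iff)
  moreover have "relmap Y (h y) (h y') = snd \<phi> (relmap Y y y')" if "y \<in> points Y" "y' \<in> points Y" for y y'
    using F(7)[of "(x, y)" "(x, y')"] that by (simp add: hx)
  ultimately have "(h, snd \<phi>) \<in> carrier (scheme_Aut Y)"
    using F(3) by (intro scheme_AutI[OF sY]) (simp_all add: h_def)
  then show ?thesis
    by (metis imageI snd_conv)
qed

text \<open>
The inverse of gluing is restriction; \<open>\<tau>\<close> is recovered from the restriction to any one fiber, and
such a fiber exists because an association scheme has an identity relation that is attained.
\<close>

lemma wreath_glue_bij:
  "bij_betw (\<lambda>(\<tau>, k). wreath_glue X Y \<tau> k)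
     (SIGMA \<tau> : snd ` carrier (scheme_Aut Y).
        \<Pi>\<^sub>E x\<in>points X. scheme_Aut_over (fiber_scheme X Y x) \<tau>)
     (carrier (wreath_K X Y))"
proof -
  obtain x where x: "x \<in> points X"
    by (rule points_X_obtain)
  let ?r = "\<lambda>k. (snd (wreath_restrict X Y k x), wreath_restrict X Y k)"
  have r: "snd (wreath_restrict X Y k x) \<in> snd ` carrier (scheme_Aut Y)"
      "wreath_restrict X Y k \<in>
        (\<Pi>\<^sub>E u\<in>points X. scheme_Aut_over (fiber_scheme X Y u) (snd (wreath_restrict X Y k x)))"
    if k: "k \<in> carrier (wreath_K X Y)" for k
  proof -
    show "snd (wreath_restrict X Y k x) \<in> snd ` carrier (scheme_Aut Y)"
      by (rule fiber_aut_rel[OF x wreath_restrict_closed[OF k x]])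
    have "snd (wreath_restrict X Y k u) = snd (wreath_restrict X Y k x)" if "u \<in> points X" for u
      using that x by (simp add: wreath_restrict_def case_prod_unfold)
    then show "wreath_restrict X Y k \<in>
        (\<Pi>\<^sub>E u\<in>points X. scheme_Aut_over (fiber_scheme X Y u) (snd (wreath_restrict X Y k x)))"
      using wreath_restrict_PiE[OF k] by (simp add: PiE_iff scheme_Aut_over_def)
  qed
  show ?thesis
  proof (rule bij_betw_byWitness[where f' = ?r])
    have "snd (k x) = \<tau>" if "k \<in> (\<Pi>\<^sub>E x\<in>points X. scheme_Aut_over (fiber_scheme X Y x) \<tau>)" for k \<tau>
      using that x by (auto simp: scheme_Aut_over_def)
    then show "\<forall>p\<in>SIGMA \<tau> : snd ` carrier (scheme_Aut Y).
        \<Pi>\<^sub>E x\<in>points X. scheme_Aut_over (fiber_scheme X Y x) \<tau>.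
        ?r ((\<lambda>(\<tau>, k). wreath_glue X Y \<tau> k) p) = p"
      by (auto simp: wreath_restrict_glue)
    show "\<forall>k\<in>carrier (wreath_K X Y). (\<lambda>(\<tau>, k). wreath_glue X Y \<tau> k) (?r k) = k"
      using r(2) by (auto intro!: K_eqI wreath_glue_closed wreath_restrict_glue)
    show "(\<lambda>(\<tau>, k). wreath_glue X Y \<tau> k) `
        (SIGMA \<tau> : snd ` carrier (scheme_Aut Y).
          \<Pi>\<^sub>E x\<in>points X. scheme_Aut_over (fiber_scheme X Y x) \<tau>) \<subseteq> carrier (wreath_K X Y)"
      using wreath_glue_closed by auto
    show "?r ` carrier (wreath_K X Y) \<subseteq>
        (SIGMA \<tau> : snd ` carrier (scheme_Aut Y).
          \<Pi>\<^sub>E x\<in>points X. scheme_Aut_over (fiber_scheme X Y x) \<tau>)"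
      using r by blast
  qed
qed

section \<open>The diagonal copy of the automorphisms of a fiber\<close>

lemma fst_diag: "z \<in> points W \<Longrightarrow> fst (wreath_diag X Y b) z = (fst z, fst b (snd z))"
  by (cases b; cases z) (simp add: wreath_diag_def)

lemma wreath_diag_closed:
  assumes b: "b \<in> carrier (scheme_Aut Y)"
  shows "wreath_diag X Y b \<in> carrier (wreath_K X Y)"
proof -
  have "bij_betw (\<lambda>z. (fst z, fst b (snd z))) (points X \<times> points Y) (points X \<times> points Y)"
    using scheme_AutD(1)[OF sY b] by (auto simp: bij_betw_def inj_on_def image_iff) (metis imageE)+
  then have "bij_betw (fst (wreath_diag X Y b)) (points W) (points W)"
    by (subst bij_betw_cong[OF fst_diag]) (simp_all add: points_W)
  then have "(fst (wreath_diag X Y b), snd (wreath_diag X Y b)) \<in> carrier (scheme_Aut W)"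
  proof (rule scheme_AutI[OF sW])
    fix z z' assume z: "z \<in> points W" "z' \<in> points W"
    then have y: "snd z \<in> points Y" "snd z' \<in> points Y"
      by (auto simp: points_W)
    have "snd (wreath_diag X Y b) (relmap W z z') = map_sum id (snd b) (relmap W z z')"
      using relmap_in_rels[OF sW z] by (cases b) (simp add: wreath_diag_def)
    then show "relmap W (fst (wreath_diag X Y b) z) (fst (wreath_diag X Y b) z') =
        snd (wreath_diag X Y b) (relmap W z z')"
      using scheme_AutD(7)[OF sY b y] z
      by (cases "fst z = fst z'") (simp_all add: fst_diag relmap_W_same relmap_W_diff)
  qed (cases b; simp add: wreath_diag_def)+
  then show ?thesis
    by (simp add: carrier_K fst_diag)
qed

lemma wreath_diag_closed_W:
  "b \<in> carrier (scheme_Aut Y) \<Longrightarrow> wreath_diag X Y b \<in> carrier (scheme_Aut W)"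
  using wreath_diag_closed carrier_K by blast

lemma wreath_diag_hom: "wreath_diag X Y \<in> hom (scheme_Aut Y) (wreath_K X Y)"
proof -
  interpret Y: group "scheme_Aut Y" by (rule group_Y)
  show ?thesis
  proof (rule homI[OF wreath_diag_closed])
    fix a b assume ab: "a \<in> carrier (scheme_Aut Y)" "b \<in> carrier (scheme_Aut Y)"
    show "wreath_diag X Y (a \<otimes>\<^bsub>scheme_Aut Y\<^esub> b) =
        wreath_diag X Y a \<otimes>\<^bsub>wreath_K X Y\<^esub> wreath_diag X Y b"
      unfolding mult_K
    proof (rule scheme_Aut_eqI[OF sW])
      fix z assume z: "z \<in> points W"
      then have "(fst z, fst b (snd z)) \<in> points W"
        using scheme_AutD(5)[OF sY ab(2)] by (auto simp: points_W)
      then show "fst (wreath_diag X Y (a \<otimes>\<^bsub>scheme_Aut Y\<^esub> b)) z =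
          fst (wreath_diag X Y a \<otimes>\<^bsub>scheme_Aut W\<^esub> wreath_diag X Y b) z"
        using z by (simp add: fst_scheme_mult fst_diag) (auto simp: fst_scheme_mult points_W)
    qed (use ab in \<open>simp_all add: wreath_diag_closed_W\<close>)
  qed
qed

lemma wreath_diag_split_commute:
  assumes b: "b \<in> carrier (scheme_Aut Y)" and a: "a \<in> carrier (scheme_Aut X)"
  shows "wreath_diag X Y b \<otimes>\<^bsub>scheme_Aut W\<^esub> wreath_split X Y a =
    wreath_split X Y a \<otimes>\<^bsub>scheme_Aut W\<^esub> wreath_diag X Y b"
proof (rule scheme_Aut_eqI[OF sW])
  fix z assume z: "z \<in> points W"
  then have "(fst z, fst b (snd z)) \<in> points W" "(fst a (fst z), snd z) \<in> points W"
    using scheme_AutD(5)[OF sY b] scheme_AutD(5)[OF sX a] by (auto simp: points_W)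
  then show "fst (wreath_diag X Y b \<otimes>\<^bsub>scheme_Aut W\<^esub> wreath_split X Y a) z =
      fst (wreath_split X Y a \<otimes>\<^bsub>scheme_Aut W\<^esub> wreath_diag X Y b) z"
    using z by (simp add: fst_scheme_mult fst_diag fst_split)
qed (use a b in \<open>simp_all add: wreath_diag_closed_W wreath_split_closed\<close>)

lemma wreath_diag_inj: "inj_on (wreath_diag X Y) (carrier (scheme_Aut Y))"
proof (rule inj_onI, rule scheme_Aut_eqI[OF sY])
  fix a b y assume eq: "wreath_diag X Y a = wreath_diag X Y b" and y: "y \<in> points Y"
  obtain x where "x \<in> points X"
    by (rule points_X_obtain)
  then show "fst a y = fst b y"
    using fst_diag[of "(x, y)" a] fst_diag[of "(x, y)" b] eq y by (simp add: points_W)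
qed

text \<open>
Projecting to the base kills the diagonal factor and returns \<open>a\<close>, so \<open>a\<close> is trivial first; then
injectivity of the diagonal embedding gives \<open>b\<close>.
\<close>

lemma wreath_diag_split_trivial:
  assumes b: "b \<in> carrier (scheme_Aut Y)" and a: "a \<in> carrier (scheme_Aut X)"
    and one: "wreath_diag X Y b \<otimes>\<^bsub>scheme_Aut W\<^esub> wreath_split X Y a = \<one>\<^bsub>scheme_Aut W\<^esub>"
  shows "b = \<one>\<^bsub>scheme_Aut Y\<^esub> \<and> a = \<one>\<^bsub>scheme_Aut X\<^esub>"
proof -
  have "wreath_P X Y (wreath_diag X Y b) = \<one>\<^bsub>scheme_Aut X\<^esub>"
    using wreath_diag_closed[OF b] by (simp add: wreath_K_def kernel_def)
  then have "wreath_P X Y (wreath_diag X Y b \<otimes>\<^bsub>scheme_Aut W\<^esub> wreath_split X Y a) = a"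
    using a b by (simp add: wreath_diag_closed_W wreath_split_closed wreath_P_split)
  then have a1: "a = \<one>\<^bsub>scheme_Aut X\<^esub>"
    using one by simp
  then have "wreath_diag X Y b = \<one>\<^bsub>wreath_K X Y\<^esub>"
    using one b by (simp add: ext.section_one wreath_diag_closed_W) (simp add: wreath_K_def)
  also have "\<dots> = wreath_diag X Y \<one>\<^bsub>scheme_Aut Y\<^esub>"
    using hom_one[OF wreath_diag_hom group_Y group_K] by simp
  finally show ?thesis
    using a1 b wreath_diag_inj group.is_monoid[OF group_Y] by (auto simp: inj_on_eq_iff monoid.one_closed)
qed

end

section \<open>The automorphism group of a wreath product\<close>

theorem theorem3p2:
  fixes X :: "('a, 'i) scheme" and Y :: "('b, 'j) scheme"
  assumes "assoc_scheme X" and "assoc_scheme Y"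
  shows
    "(\<forall>(f, \<sigma>) \<in> carrier (scheme_Aut (wreath X Y)).
        (\<forall>x\<in>points X. \<exists>x'\<in>points X. f ` fiber X Y x = fiber X Y x') \<and>
        (\<exists>!g. g \<in> carrier (BijGroup (points X)) \<and>
              (\<forall>z\<in>points (wreath X Y). fst (f z) = g (fst z))) \<and>
        (\<exists>!\<phi>. \<phi> \<in> carrier (scheme_Aut X) \<and> fst \<phi> = induced_bij X Y f)) \<and>
     group_hom (scheme_Aut (wreath X Y)) (scheme_Aut X) (wreath_P X Y) \<and>
     wreath_P X Y ` carrier (scheme_Aut (wreath X Y)) = carrier (scheme_Aut X) \<and>
     wreath_split X Y \<in> hom (scheme_Aut X) (scheme_Aut (wreath X Y)) \<and>
     (\<forall>a\<in>carrier (scheme_Aut X). wreath_P X Y (wreath_split X Y a) = a) \<and>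
     wreath_act X Y \<in> hom (scheme_Aut X) (AutoGroup (wreath_K X Y)) \<and>
     (\<lambda>(k, a). k \<otimes>\<^bsub>scheme_Aut (wreath X Y)\<^esub> wreath_split X Y a)
       \<in> iso (semidirect (wreath_K X Y) (scheme_Aut X) (wreath_act X Y)) (scheme_Aut (wreath X Y)) \<and>
     scheme_Aut (wreath X Y) \<cong> semidirect (wreath_K X Y) (scheme_Aut X) (wreath_act X Y) \<and>
     wreath_restrict X Y \<in> mon (wreath_K X Y)
       (product_group (points X) (\<lambda>x. scheme_Aut (fiber_scheme X Y x))) \<and>
     subgroup (wreath_restrict X Y ` carrier (wreath_K X Y))
       (product_group (points X) (\<lambda>x. scheme_Aut (fiber_scheme X Y x))) \<and>
     snd ` carrier (scheme_Aut Y) \<subseteq> carrier (BijGroup (rels Y)) \<and>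
     bij_betw (\<lambda>(\<tau>, k). wreath_glue X Y \<tau> k)
       (SIGMA \<tau> : snd ` carrier (scheme_Aut Y).
          \<Pi>\<^sub>E x\<in>points X. scheme_Aut_over (fiber_scheme X Y x) \<tau>)
       (carrier (wreath_K X Y)) \<and>
     (\<forall>\<tau> \<in> snd ` carrier (scheme_Aut Y).
        \<forall>k \<in> (\<Pi>\<^sub>E x\<in>points X. scheme_Aut_over (fiber_scheme X Y x) \<tau>).
          wreath_restrict X Y (wreath_glue X Y \<tau> k) = k) \<and>
     wreath_diag X Y \<in> mon (scheme_Aut Y) (wreath_K X Y) \<and>
     (\<forall>b\<in>carrier (scheme_Aut Y). \<forall>a\<in>carrier (scheme_Aut X).
        wreath_diag X Y b \<otimes>\<^bsub>scheme_Aut (wreath X Y)\<^esub> wreath_split X Y a =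
        wreath_split X Y a \<otimes>\<^bsub>scheme_Aut (wreath X Y)\<^esub> wreath_diag X Y b) \<and>
     (\<exists>H. subgroup H (scheme_Aut (wreath X Y)) \<and>
        (scheme_Aut (wreath X Y))\<lparr>carrier := H\<rparr> \<cong> scheme_Aut Y \<times>\<times> scheme_Aut X)"
proof -
  interpret wreath_pair X Y
    using assms by unfold_locales
  let ?W = "scheme_Aut (wreath X Y)"
  have "\<forall>(f, \<sigma>) \<in> carrier ?W.
      (\<forall>x\<in>points X. \<exists>x'\<in>points X. f ` fiber X Y x = fiber X Y x') \<and>
      (\<exists>!g. g \<in> carrier (BijGroup (points X)) \<and>
            (\<forall>z\<in>points (wreath X Y). fst (f z) = g (fst z))) \<and>
      (\<exists>!\<phi>. \<phi> \<in> carrier (scheme_Aut X) \<and> fst \<phi> = induced_bij X Y f)"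
  proof (intro ballI, unfold case_prod_unfold, intro conjI ballI)
    fix \<phi> assume \<phi>: "\<phi> \<in> carrier ?W"
    show "\<exists>x'\<in>points X. fst \<phi> ` fiber X Y x = fiber X Y x'" if "x \<in> points X" for x
      using aut_maps_fiber[OF \<phi> that] bij_betw_apply[OF base_map_bij[OF \<phi>] that] by blast
  qed (simp_all add: base_map_unique base_aut_unique)
  moreover have "wreath_P X Y ` carrier ?W = carrier (scheme_Aut X)"
    using wreath_P_closed wreath_split_closed wreath_P_split by (force simp: image_iff)
  moreover have "wreath_act X Y \<in> hom (scheme_Aut X) (AutoGroup (wreath_K X Y))"
    using ext.conj_act_hom by (simp add: wreath_act_eq wreath_K_def)
  moreover have "(\<lambda>(k, a). k \<otimes>\<^bsub>?W\<^esub> wreath_split X Y a)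
      \<in> iso (semidirect (wreath_K X Y) (scheme_Aut X) (wreath_act X Y)) ?W"
    using ext.semidirect_iso by (simp add: wreath_act_eq wreath_K_def)
  moreover have "?W \<cong> semidirect (wreath_K X Y) (scheme_Aut X) (wreath_act X Y)"
    using ext.iso_semidirect by (simp add: wreath_act_eq wreath_K_def)
  moreover have "wreath_restrict X Y \<in> mon (wreath_K X Y)
      (product_group (points X) (\<lambda>x. scheme_Aut (fiber_scheme X Y x)))"
    using group_hom.homh[OF wreath_restrict_hom] K_eqI by (simp add: mon_def inj_on_def)
  moreover have "snd ` carrier (scheme_Aut Y) \<subseteq> carrier (BijGroup (rels Y))"
    using scheme_AutD(3,4)[OF sY] by (auto simp: BijGroup_def Bij_def)
  moreover have "wreath_diag X Y \<in> mon (scheme_Aut Y) (wreath_K X Y)"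
    using wreath_diag_hom wreath_diag_inj by (simp add: mon_def)
  moreover have "\<exists>H. subgroup H ?W \<and> ?W\<lparr>carrier := H\<rparr> \<cong> scheme_Aut Y \<times>\<times> scheme_Aut X"
  proof (rule commuting_product_iso[OF group_W group_Y group_X _ wreath_split_hom])
    show "wreath_diag X Y \<in> hom (scheme_Aut Y) ?W"
      using wreath_diag_hom by (auto simp: hom_def mult_K wreath_diag_closed_W)
  qed (simp_all add: wreath_diag_split_commute wreath_diag_split_trivial)
  moreover have "\<forall>a\<in>carrier (scheme_Aut X). wreath_P X Y (wreath_split X Y a) = a"
    using wreath_P_split by blast
  moreover have "\<forall>\<tau> \<in> snd ` carrier (scheme_Aut Y).
      \<forall>k \<in> (\<Pi>\<^sub>E x\<in>points X. scheme_Aut_over (fiber_scheme X Y x) \<tau>).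
        wreath_restrict X Y (wreath_glue X Y \<tau> k) = k"
    using wreath_restrict_glue by blast
  moreover have "\<forall>b\<in>carrier (scheme_Aut Y). \<forall>a\<in>carrier (scheme_Aut X).
      wreath_diag X Y b \<otimes>\<^bsub>?W\<^esub> wreath_split X Y a =
      wreath_split X Y a \<otimes>\<^bsub>?W\<^esub> wreath_diag X Y b"
    using wreath_diag_split_commute by blast
  moreover note wreath_P_hom wreath_split_hom wreath_glue_bij
    group_hom.img_is_subgroup[OF wreath_restrict_hom]
  ultimately show ?thesis
    by (intro conjI)
qed

end
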